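(* Let $k$ be a field of characteristic $0$, and let $I$ be a homogeneous ideal of $k[x_1,\ldots,x_d]$. Then the rational symbolic power $\overline{I^{(u)}}$ is strongly Golod for every rational number $u\ge 2$.
   Context: Write $R=k[x_1,\dots,x_d]$. A homogeneous ideal $J$ of $R$ ($k$ of characteristic $0$) is strongly Golod if $\partial(J)^2\subseteq J$, where $\partial(J)$ is the ideal generated by all partial derivatives $\frac{\partial f}{\partial x_i}$ with $f\in J$ and $i=1,\dots,d$. $\mathrm{Ass}(I)$ denotes $\mathrm{Ass}_R(R/I)$, and $\overline J$ the integral closure of an ideal $J$. For a positive rational number $u=\frac pq$ ($p,q$ positive integers), the $u$-th rational power of $I$ is $\overline{I^u}=\{f\in R \mid f^q\in \overline{I^p}\}$ ($\overline{I^p}$ being the integral closure of $I^p$), independent of the presentation of $u$. The $u$-th rational symbolic power of $I$ is $\overline{I^{(u)}}=\bigcap_{\mathfrak p\in \mathrm{Ass}(I)}(\overline{I^u}R_{\mathfrak p}\cap R)$, also for integer $u$. *)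

theory Defs
  imports
    Complex_Main
    "HOL-Library.Poly_Mapping"
    "HOL-Computational_Algebra.Fraction_Field"
begin

section \<open>Ideals of a commutative ring\<close>

text \<open>Ideals are the submodules of the ring regarded as a module over itself, so that
  \<open>ideal.subspace J\<close> says that \<open>J\<close> is an ideal and \<open>ideal.span S\<close> is the ideal
  generated by \<open>S\<close>.\<close>

interpretation ideal: module "(*) :: 'a::comm_ring_1 \<Rightarrow> 'a \<Rightarrow> 'a"
  by standard (simp_all add: algebra_simps)

definition ideal_prod :: "'a::comm_ring_1 set \<Rightarrow> 'a set \<Rightarrow> 'a set" where
  "ideal_prod I J = ideal.span {a * b | a b. a \<in> I \<and> b \<in> J}"

primrec ideal_power :: "'a::comm_ring_1 set \<Rightarrow> nat \<Rightarrow> 'a set" where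
  "ideal_power I 0 = UNIV"
| "ideal_power I (Suc n) = ideal_prod I (ideal_power I n)"

definition prime_ideal :: "'a::comm_ring_1 set \<Rightarrow> bool" where
  "prime_ideal P \<longleftrightarrow> ideal.subspace P \<and> P \<noteq> UNIV \<and> (\<forall>a b. a * b \<in> P \<longrightarrow> a \<in> P \<or> b \<in> P)"

text \<open>The associated primes of the module \<open>R/I\<close>: the annihilator of the class of \<open>f\<close> in
  \<open>R/I\<close> is \<open>{r. r * f \<in> I}\<close>.\<close>

definition Ass :: "'a::comm_ring_1 set \<Rightarrow> 'a set set" where
  "Ass I = {P. prime_ideal P \<and> (\<exists>f. P = {r. r * f \<in> I})}"

definition integral_closure :: "'a::comm_ring_1 set \<Rightarrow> 'a set" where
  "integral_closure J =
    {f. \<exists>n a. n \<ge> 1 \<and> (\<forall>i\<in>{1..n}. a i \<in> ideal_power J i) \<and>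
        f ^ n + (\<Sum>i=1..n. a i * f ^ (n - i)) = 0}"


section \<open>Localization of a domain at a prime\<close>

text \<open>For a domain \<open>R\<close> with prime \<open>P\<close> the ring \<open>R\<^sub>P\<close> is taken inside the fraction field of
  \<open>R\<close>, and \<open>f\<close> is identified with \<open>f/1\<close>.\<close>

definition localization :: "'a::idom set \<Rightarrow> 'a fract set" where
  "localization P = {Fract r s | r s. s \<notin> P}"

definition local_extension :: "'a::idom set \<Rightarrow> 'a set \<Rightarrow> 'a fract set" where
  "local_extension P J =
    {\<Sum>i<n. c i * Fract (g i) 1 | (n::nat) c g. \<forall>i<n. c i \<in> localization P \<and> g i \<in> J}"

definition local_contraction :: "'a::idom set \<Rightarrow> 'a set \<Rightarrow> 'a set" where
  "local_contraction P J = {f. Fract f 1 \<in> local_extension P J}"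


section \<open>Rational powers and rational symbolic powers\<close>

text \<open>The rational number \<open>u\<close> is presented in lowest terms with positive denominator by
  \<^const>\<open>quotient_of\<close>; the resulting set does not depend on the presentation.
  These are meant for \<open>u > 0\<close> only.\<close>

definition rational_power :: "'a::comm_ring_1 set \<Rightarrow> rat \<Rightarrow> 'a set" where
  "rational_power I u =
    (case quotient_of u of (p, q) \<Rightarrow> {f. f ^ nat q \<in> integral_closure (ideal_power I (nat p))})"

definition rational_symbolic_power :: "'a::idom set \<Rightarrow> rat \<Rightarrow> 'a set" where
  "rational_symbolic_power I u = (\<Inter>P\<in>Ass I. local_contraction P (rational_power I u))"


section \<open>Polynomial rings and the strongly Golod property\<close>

text \<open>\<open>('n, 'k) mpoly\<close> is the polynomial ring over \<open>'k\<close> in the variables indexed by the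
  (finite) type \<open>'n\<close>; monomials are exponent vectors. When \<open>'n\<close> is linearly ordered the
  library makes this ring an integral domain.\<close>

type_synonym ('n, 'k) mpoly = "('n \<Rightarrow>\<^sub>0 nat) \<Rightarrow>\<^sub>0 'k"

definition monomial_degree :: "('n::finite \<Rightarrow>\<^sub>0 nat) \<Rightarrow> nat" where
  "monomial_degree m = (\<Sum>i\<in>UNIV. Poly_Mapping.lookup m i)"

definition homogeneous :: "('n::finite, 'k::zero) mpoly \<Rightarrow> bool" where
  "homogeneous f \<longleftrightarrow> (\<exists>n. \<forall>m\<in>Poly_Mapping.keys f. monomial_degree m = n)"

definition homogeneous_ideal :: "('n::finite, 'k::comm_ring_1) mpoly set \<Rightarrow> bool" where
  "homogeneous_ideal J \<longleftrightarrow> (\<exists>S. (\<forall>f\<in>S. homogeneous f) \<and> J = ideal.span S)"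

text \<open>The exponent subtraction is truncated, which is harmless: the coefficient vanishes whenever
  the exponent of the variable \<open>i\<close> in \<open>m\<close> is zero.\<close>

definition partial_deriv :: "'n \<Rightarrow> ('n, 'k::comm_ring_1) mpoly \<Rightarrow> ('n, 'k) mpoly" where
  "partial_deriv i f =
    (\<Sum>m\<in>Poly_Mapping.keys f.
      Poly_Mapping.single (m - Poly_Mapping.single i 1)
        (of_nat (Poly_Mapping.lookup m i) * Poly_Mapping.lookup f m))"

definition derivative_ideal :: "('n, 'k::comm_ring_1) mpoly set \<Rightarrow> ('n, 'k) mpoly set" where
  "derivative_ideal J = ideal.span {partial_deriv i f | i f. f \<in> J}"

definition strongly_Golod :: "('n::finite, 'k::field_char_0) mpoly set \<Rightarrow> bool" where
  "strongly_Golod J \<longleftrightarrow> homogeneous_ideal J \<and> ideal_power (derivative_ideal J) 2 \<subseteq> J"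

end

theory Submission
  imports Defs "Jordan_Normal_Form.Char_Poly"
begin

text \<open>Write \<open>R\<close> for the polynomial ring and \<open>I\<^sup>u\<close> for the
  \<open>u\<close>-th rational power, \<open>u = p / q\<close>. The heart of the matter is that a partial
  derivative costs at most one unit of exponent: it maps \<open>I\<^sup>u\<close> into
  \<open>I\<^bsup>u-1\<^esup>\<close> for \<open>u \<ge> 1\<close>. Since rational powers multiply, two
  derivatives then have a product in \<open>I\<^bsup>2u-2\<^esup>\<close>, and this lies in
  \<open>I\<^sup>u\<close> as soon as \<open>u \<ge> 2\<close>.

  The loss of one unit comes from the Taylor expansion. The substitution \<open>x\<^sub>i \<mapsto> x\<^sub>i +
  t\<close> is a ring homomorphism \<open>\<phi>\<close> from \<open>R\<close> to \<open>R[t]\<close> with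
  \<open>\<phi>(f) = f + t \<partial>\<^sub>if + \<dots>\<close>, and it maps \<open>I\<close> into \<open>K = I
  + (t)\<close>. Integral equations are preserved by ring homomorphisms, so \<open>\<phi>\<close> maps
  \<open>I\<^sup>u\<close> into \<open>K\<^sup>u\<close>. The ideal \<open>K\<^sup>u\<close> is stable under
  \<open>t \<mapsto> 2\<^sup>k t\<close> for all \<open>k\<close>, and inverting a Vandermonde system over the
  rationals shows that it contains the separate terms of each of its elements; in particular \<open>t
  \<partial>\<^sub>if\<close> lies in \<open>K\<^sup>u\<close>. In an integral equation for \<open>t g\<close>
  over a power of \<open>K\<close>, comparing the coefficients of the leading power of \<open>t\<close> gives an
  integral equation for \<open>g\<close> in which each coefficient has lost as many factors from
  \<open>I\<close> as it has factors \<open>t\<close>; this says that \<open>g\<close> is in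
  \<open>I\<^bsup>u-1\<^esup>\<close>. See \<open>first_order_coeff_in_fractional_power\<close> and
  \<open>partial_deriv_fractional_power\<close>.

  All this uses that rational powers are ideals and that they multiply. To see it, \<open>f\<close> is encoded
  as the monomial \<open>f s\<^sup>p\<close>, with \<open>s\<close> standing for a \<open>q\<close>-th root of
  the variable of the Rees algebra of \<open>I\<close>: then \<open>f\<close> is in
  \<open>I\<^bsup>p/q\<^esup>\<close> if and only if \<open>f s\<^sup>p\<close> is integral over a fixed
  subring of \<open>R[s]\<close> (\<open>fractional_power_iff_integral\<close>), and elements integral over a
  subring are closed under sums and products by the determinant trick.

  The localizations only introduce denominators. An element \<open>f\<close> is in the symbolic power if for
  each associated prime \<open>P\<close> some \<open>s \<notin> P\<close> has \<open>s f \<in>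
  I\<^sup>u\<close>, and the Leibniz rule turns this into \<open>s\<^sup>2 \<partial>\<^sub>if \<in>
  I\<^bsup>u-1\<^esup>\<close>.

  Homogeneity follows from symmetry. The dilations \<open>x \<mapsto> a x\<close>, with \<open>a \<noteq>
  0\<close> in the field, are automorphisms that preserve \<open>I\<close>; they permute the associated primes
  and therefore preserve the symbolic power, and the same Vandermonde argument extracts homogeneous
  components.\<close>

text \<open>As a simplification rule, \<open>ideal.scale_scale\<close> reassociates products to the left and so
  makes the simplifier loop together with \<open>mult.assoc\<close> or \<open>mult_ac\<close>.\<close>

declare ideal.scale_scale [simp del]

section \<open>Elements integral over a subring\<close>

definition is_subring :: "'a::comm_ring_1 set \<Rightarrow> bool" where
  "is_subring A \<longleftrightarrow> 1 \<in> A \<and> (\<forall>x\<in>A. \<forall>y\<in>A. x - y \<in> A \<and> x * y \<in> A)"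

context
  fixes A :: "'a::comm_ring_1 set"
  assumes A: "is_subring A"
begin

lemma subring_one: "1 \<in> A"
  and subring_diff: "x \<in> A \<Longrightarrow> y \<in> A \<Longrightarrow> x - y \<in> A"
  and subring_mult: "x \<in> A \<Longrightarrow> y \<in> A \<Longrightarrow> x * y \<in> A"
  using A by (auto simp: is_subring_def)

lemma subring_zero: "0 \<in> A"
  using subring_diff[OF subring_one subring_one] by simp

lemma subring_uminus: "x \<in> A \<Longrightarrow> - x \<in> A"
  using subring_diff[OF subring_zero, of x] by simp

lemma subring_add: "x \<in> A \<Longrightarrow> y \<in> A \<Longrightarrow> x + y \<in> A"
  using subring_diff[of x "- y"] subring_uminus[of y] by simp

lemma subring_sum: "(\<And>i. i \<in> S \<Longrightarrow> f i \<in> A) \<Longrightarrow> sum f S \<in> A"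
  by (induction S rule: infinite_finite_induct) (auto intro: subring_zero subring_add)

lemma subring_prod: "(\<And>i. i \<in> S \<Longrightarrow> f i \<in> A) \<Longrightarrow> prod f S \<in> A"
  by (induction S rule: infinite_finite_induct) (auto intro: subring_one subring_mult)

lemma is_subring_poly: "is_subring {p :: 'a poly. \<forall>i. coeff p i \<in> A}"
  unfolding is_subring_def mem_Collect_eq
proof (intro conjI ballI allI)
  show "coeff (1 :: 'a poly) i \<in> A" for i
    by (cases i) (auto simp: subring_one subring_zero coeff_pCons one_pCons)
  fix p q :: "'a poly" and i
  assume "p \<in> {p. \<forall>i. coeff p i \<in> A}" "q \<in> {p. \<forall>i. coeff p i \<in> A}"
  then have "coeff p j \<in> A" "coeff q j \<in> A" for j by auto
  then show "coeff (p - q) i \<in> A" "coeff (p * q) i \<in> A"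
    unfolding coeff_diff coeff_mult by (intro subring_diff subring_sum subring_mult; simp)+
qed

end

lemma subring_det:
  assumes A: "is_subring A" and M: "M \<in> carrier_mat n n"
    and "\<And>i j. i < n \<Longrightarrow> j < n \<Longrightarrow> M $$ (i, j) \<in> A"
  shows "det M \<in> A"
proof -
  have "signof p * x \<in> A" if "x \<in> A" for p :: "nat \<Rightarrow> nat" and x
    using that by (cases p rule: sign_cases) (auto intro: subring_uminus[OF A])
  then show ?thesis
    unfolding det_def'[OF M]
    using assms(3)
    by (intro subring_sum[OF A] \<open>\<And>p x. x \<in> A \<Longrightarrow> signof p * x \<in> A\<close> subring_prod[OF A])
      (auto simp: permutes_in_image)
qed

definition span_over :: "'a::comm_ring_1 set \<Rightarrow> ('b \<Rightarrow> 'a) \<Rightarrow> 'b set \<Rightarrow> 'a set" where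
  "span_over A v B = {\<Sum>b\<in>B. c b * v b | c. \<forall>b\<in>B. c b \<in> A}"

lemma span_overI:
  "x = (\<Sum>b\<in>B. c b * v b) \<Longrightarrow> (\<And>b. b \<in> B \<Longrightarrow> c b \<in> A) \<Longrightarrow> x \<in> span_over A v B"
  unfolding span_over_def by auto

lemma span_overE:
  assumes "x \<in> span_over A v B"
  obtains c where "x = (\<Sum>b\<in>B. c b * v b)" "\<And>b. b \<in> B \<Longrightarrow> c b \<in> A"
  using assms unfolding span_over_def by auto

text \<open>A monic equation of degree \<open>0\<close> reads \<open>1 = 0\<close>, so \<open>n > 0\<close> is
  automatic.\<close>

definition integral_over :: "'a::comm_ring_1 set \<Rightarrow> 'a \<Rightarrow> bool" where
  "integral_over A x \<longleftrightarrow> (\<exists>n c. (\<forall>i<n. c i \<in> A) \<and> x ^ n = (\<Sum>i<n. c i * x ^ i))"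

lemma integral_over_if_monic_root:
  assumes A: "is_subring A" and "\<And>i. coeff p i \<in> A" "coeff p (degree p) = 1" "poly p x = 0"
  shows "integral_over A x"
proof -
  let ?n = "degree p"
  have "0 = (\<Sum>i<?n. coeff p i * x ^ i) + x ^ ?n"
    using assms(3,4) by (simp add: poly_altdef lessThan_Suc_atMost[symmetric])
  then have "x ^ ?n = (\<Sum>i<?n. - coeff p i * x ^ i)"
    unfolding mult_minus_left sum_negf by (metis add.inverse_unique)
  then show ?thesis
    unfolding integral_over_def using assms(2) subring_uminus[OF A]
    by (intro exI[of _ ?n] exI[of _ "\<lambda>i. - coeff p i"]) simp
qed

text \<open>The determinant trick. Multiplication by \<open>z\<close> acts on the generators \<open>v b\<close>
  through a matrix \<open>M\<close> over \<open>A\<close>, so \<open>z - M\<close> annihilates the vector of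
  generators. Multiplying by the adjugate, \<open>det (z - M)\<close> annihilates every generator and hence
  \<open>1\<close>, and \<open>z\<close> is a root of the characteristic polynomial of \<open>M\<close>.\<close>

lemma integral_over_if_stable_span:
  fixes v :: "'b \<Rightarrow> 'a::comm_ring_1"
  assumes A: "is_subring A" and B: "finite B" and one: "1 \<in> span_over A v B"
    and stable: "\<And>b. b \<in> B \<Longrightarrow> z * v b \<in> span_over A v B"
  shows "integral_over A z"
proof -
  define N where "N = card B"
  obtain h where h: "bij_betw h {..<N} B"
    using ex_bij_betw_nat_finite[OF B] by (auto simp: N_def atLeast0LessThan)
  have "\<forall>b\<in>B. \<exists>c. (\<forall>b'\<in>B. c b' \<in> A) \<and> z * v b = (\<Sum>b'\<in>B. c b' * v b')"
    using stable unfolding span_over_def by blast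
  then obtain c where cA: "\<And>b b'. b \<in> B \<Longrightarrow> b' \<in> B \<Longrightarrow> c b b' \<in> A"
    and c: "\<And>b. b \<in> B \<Longrightarrow> z * v b = (\<Sum>b'\<in>B. c b b' * v b')"
    by metis
  have hB: "h i \<in> B" if "i < N" for i using h that by (auto dest: bij_betwE)
  define M where "M = mat N N (\<lambda>(i, j). c (h i) (h j))"
  define D where "D = mat N N (\<lambda>(i, j). (if i = j then z else 0) - c (h i) (h j))"
  define w where "w = vec N (\<lambda>i. v (h i))"
  have M: "M \<in> carrier_mat N N" and D: "D \<in> carrier_mat N N" and w: "w \<in> carrier_vec N"
    by (auto simp: M_def D_def w_def)
  \<comment> \<open>\<open>D = z - M\<close> kills the vector of generators.\<close>
  have "D *\<^sub>v w = 0\<^sub>v N"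
  proof (rule eq_vecI)
    fix i assume "i < dim_vec (0\<^sub>v N :: 'a vec)"
    then have i: "i < N" by simp
    have "(D *\<^sub>v w) $ i = (\<Sum>j<N. ((if i = j then z else 0) - c (h i) (h j)) * v (h j))"
      using i by (simp add: D_def w_def scalar_prod_def atLeast0LessThan)
    also have "\<dots> = (\<Sum>j<N. (if i = j then z * v (h j) else 0)) - (\<Sum>j<N. c (h i) (h j) * v (h j))"
      unfolding sum_subtractf[symmetric] by (intro sum.cong) (auto simp: algebra_simps)
    also have "(\<Sum>j<N. c (h i) (h j) * v (h j)) = (\<Sum>b\<in>B. c (h i) b * v b)"
      by (rule sum.reindex_bij_betw[OF h])
    also have "(\<Sum>j<N. (if i = j then z * v (h j) else 0)) = z * v (h i)"
      using i by simp
    finally show "(D *\<^sub>v w) $ i = 0\<^sub>v N $ i" using c[OF hB[OF i]] i by simp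
  qed (simp add: D_def)
  then have "(adj_mat D * D) *\<^sub>v w = 0\<^sub>v N"
    using assoc_mult_mat_vec[OF adj_mat(1)[OF D] D w] adj_mat(1)[OF D]
    by auto
  then have det_w: "(det D \<cdot>\<^sub>m 1\<^sub>m N) *\<^sub>v w = 0\<^sub>v N"
    using adj_mat(3)[OF D] by simp
  have det_v: "det D * v b = 0" if "b \<in> B" for b
  proof -
    obtain i where i: "i < N" "b = h i" using h \<open>b \<in> B\<close> by (auto simp: bij_betw_def)
    have "((det D \<cdot>\<^sub>m 1\<^sub>m N) *\<^sub>v w) $ i = (\<Sum>j<N. det D * (if j = i then 1 else 0) * v (h j))"
      using i(1) by (simp add: w_def scalar_prod_def atLeast0LessThan)
    also have "\<dots> = (\<Sum>j<N. if j = i then det D * v (h i) else 0)"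
      by (rule sum.cong) auto
    finally show ?thesis using i by (simp add: det_w)
  qed
  have "det D * x = 0" if "x \<in> span_over A v B" for x
  proof -
    from that obtain e where e: "x = (\<Sum>b\<in>B. e b * v b)" unfolding span_over_def by auto
    have "det D * x = (\<Sum>b\<in>B. e b * (det D * v b))"
      unfolding e sum_distrib_left by (intro sum.cong refl mult.left_commute)
    then show ?thesis using det_v by simp
  qed
  from this[OF one] have det0: "det D = 0" by simp
  have root: "poly (char_poly M) z = 0"
    unfolding char_poly_def det0[symmetric]
    by (rule poly_det_cong[OF D]) (auto simp: char_poly_matrix_def M_def D_def)
  have "char_poly M \<in> {p. \<forall>i. coeff p i \<in> A}"
    unfolding char_poly_def
  proof (rule subring_det[OF is_subring_poly[OF A]])
    show "char_poly_matrix M \<in> carrier_mat N N" using M by simp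
    show "char_poly_matrix M $$ (i, j) \<in> {p. \<forall>i. coeff p i \<in> A}" if "i < N" "j < N" for i j
      using that cA[OF hB hB]
      by (auto simp: char_poly_matrix_def M_def coeff_pCons split: nat.split
          intro: subring_zero[OF A] subring_one[OF A] subring_uminus[OF A])
  qed
  then show ?thesis
    using integral_over_if_monic_root[OF A _ _ root] degree_monic_char_poly[OF M] by simp
qed

context
  fixes A :: "'a::comm_ring_1 set"
  assumes A: "is_subring A"
begin

lemma span_over_0: "0 \<in> span_over A v B"
  by (rule span_overI[where c = "\<lambda>_. 0"]) (simp_all add: subring_zero[OF A])

lemma span_over_add:
  assumes "x \<in> span_over A v B" "y \<in> span_over A v B"
  shows "x + y \<in> span_over A v B"
proof -
  obtain c where c: "x = (\<Sum>b\<in>B. c b * v b)" "\<And>b. b \<in> B \<Longrightarrow> c b \<in> A"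
    using span_overE[OF assms(1)] by blast
  obtain d where d: "y = (\<Sum>b\<in>B. d b * v b)" "\<And>b. b \<in> B \<Longrightarrow> d b \<in> A"
    using span_overE[OF assms(2)] by blast
  show ?thesis
    by (rule span_overI[where c = "\<lambda>b. c b + d b"])
      (simp_all add: c d distrib_right sum.distrib subring_add[OF A])
qed

lemma span_over_scale:
  assumes "a \<in> A" "x \<in> span_over A v B"
  shows "a * x \<in> span_over A v B"
proof -
  obtain c where c: "x = (\<Sum>b\<in>B. c b * v b)" "\<And>b. b \<in> B \<Longrightarrow> c b \<in> A"
    using span_overE[OF assms(2)] by blast
  show ?thesis
    by (rule span_overI[where c = "\<lambda>b. a * c b"])
      (simp_all add: c assms(1) sum_distrib_left mult.assoc subring_mult[OF A])
qed

lemma span_over_sum: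
  "(\<And>i. i \<in> S \<Longrightarrow> f i \<in> span_over A v B) \<Longrightarrow> sum f S \<in> span_over A v B"
  by (induction S rule: infinite_finite_induct) (auto intro: span_over_0 span_over_add)

lemma span_over_base:
  assumes "finite B" "b \<in> B"
  shows "v b \<in> span_over A v B"
proof (rule span_overI[where c = "\<lambda>b'. if b' = b then 1 else 0"])
  show "v b = (\<Sum>b'\<in>B. (if b' = b then 1 else 0) * v b')"
    using assms by (simp add: if_distrib[of "\<lambda>x. x * _"] cong: if_cong)
qed (auto intro: subring_zero[OF A] subring_one[OF A])

lemma span_over_mult:
  assumes "x \<in> span_over A v B" "\<And>b. b \<in> B \<Longrightarrow> z * v b \<in> span_over A w C"
  shows "z * x \<in> span_over A w C"
proof -
  obtain c where c: "x = (\<Sum>b\<in>B. c b * v b)" "\<And>b. b \<in> B \<Longrightarrow> c b \<in> A"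
    using span_overE[OF assms(1)] by blast
  have "z * x = (\<Sum>b\<in>B. c b * (z * v b))"
    unfolding c(1) sum_distrib_left by (intro sum.cong refl mult.left_commute)
  also have "\<dots> \<in> span_over A w C"
    by (rule span_over_sum, rule span_over_scale) (fact c(2), fact assms(2))
  finally show ?thesis .
qed

lemma integral_over_subring:
  assumes "a \<in> A" shows "integral_over A a"
  unfolding integral_over_def
  using assms by (intro exI[of _ 1] exI[of _ "\<lambda>_. a"]) simp

text \<open>The module spanned by the products \<open>x\<^sup>i y\<^sup>j\<close> with exponents below the
  degrees of the two monic equations is stable under multiplication by \<open>x\<close> and by \<open>y\<close>,
  so that the determinant trick applies to every polynomial expression in \<open>x\<close> and
  \<open>y\<close>.\<close>

lemma integral_over_common_span:
  assumes "integral_over A x" "integral_over A y"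
  obtains v :: "nat \<times> nat \<Rightarrow> 'a" and B where "finite B" "1 \<in> span_over A v B"
    "\<And>w. w \<in> span_over A v B \<Longrightarrow> x * w \<in> span_over A v B"
    "\<And>w. w \<in> span_over A v B \<Longrightarrow> y * w \<in> span_over A v B"
proof -
  obtain n c where c: "\<And>i. i < n \<Longrightarrow> c i \<in> A" and xn: "x ^ n = (\<Sum>i<n. c i * x ^ i)"
    using assms(1) unfolding integral_over_def by blast
  obtain m d where d: "\<And>i. i < m \<Longrightarrow> d i \<in> A" and ym: "y ^ m = (\<Sum>i<m. d i * y ^ i)"
    using assms(2) unfolding integral_over_def by blast
  define v where "v = (\<lambda>(i, j). x ^ i * y ^ j)"
  define B where "B = {..<n} \<times> {..<m}"
  have B: "finite B" by (simp add: B_def)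
  have vB: "x ^ i * y ^ j \<in> span_over A v B" if "i < n" "j < m" for i j
    using span_over_base[OF B, of "(i, j)" v] that by (simp add: v_def B_def)
  have "n > 0" "m > 0" using xn ym by (auto intro!: gr0I)
  then have one: "1 \<in> span_over A v B" using vB[of 0 0] by simp
  have x: "x * w \<in> span_over A v B" if "w \<in> span_over A v B" for w
  proof (rule span_over_mult[OF that])
    fix b assume "b \<in> B"
    then obtain i j where b: "b = (i, j)" "i < n" "j < m" by (auto simp: B_def)
    show "x * v b \<in> span_over A v B"
    proof (cases "Suc i = n")
      case True
      have "x * v b = (\<Sum>k<n. c k * (x ^ k * y ^ j))"
        proof -
        have "x * v b = x ^ n * y ^ j"
          using True b(1) by (auto simp: v_def mult.assoc)
        then show ?thesis unfolding xn by (simp add: sum_distrib_right mult.assoc)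
      qed
      also have "\<dots> \<in> span_over A v B"
        by (intro span_over_sum span_over_scale c vB b) auto
      finally show ?thesis .
    next
      case False
      then show ?thesis using vB[of "Suc i" j] b by (simp add: v_def mult.assoc)
    qed
  qed
  have y: "y * w \<in> span_over A v B" if "w \<in> span_over A v B" for w
  proof (rule span_over_mult[OF that])
    fix b assume "b \<in> B"
    then obtain i j where b: "b = (i, j)" "i < n" "j < m" by (auto simp: B_def)
    show "y * v b \<in> span_over A v B"
    proof (cases "Suc j = m")
      case True
      have "y * v b = x ^ i * y ^ m"
        using True b(1) by (auto simp: v_def mult.left_commute)
      also have "\<dots> = (\<Sum>k<m. d k * (x ^ i * y ^ k))"
        unfolding ym sum_distrib_left by (intro sum.cong refl mult.left_commute)
      also have "\<dots> \<in> span_over A v B"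
        by (intro span_over_sum span_over_scale d vB b) auto
      finally show ?thesis .
    next
      case False
      then show ?thesis using vB[of i "Suc j"] b by (simp add: v_def mult.left_commute)
    qed
  qed
  show thesis by (rule that[OF B one x y])
qed

lemma integral_over_add:
  assumes "integral_over A x" "integral_over A y"
  shows "integral_over A (x + y)"
proof -
  obtain v :: "nat \<times> nat \<Rightarrow> 'a" and B where *: "finite B" "1 \<in> span_over A v B"
    "\<And>w. w \<in> span_over A v B \<Longrightarrow> x * w \<in> span_over A v B"
    "\<And>w. w \<in> span_over A v B \<Longrightarrow> y * w \<in> span_over A v B"
    by (rule integral_over_common_span[OF assms], rule that)
  show ?thesis
  proof (rule integral_over_if_stable_span[OF A *(1,2)])
    fix b assume "b \<in> B"
    then show "(x + y) * v b \<in> span_over A v B"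
      unfolding distrib_right by (intro span_over_add *(3,4) span_over_base[OF *(1)])
  qed
qed

lemma integral_over_mult:
  assumes "integral_over A x" "integral_over A y"
  shows "integral_over A (x * y)"
proof -
  obtain v :: "nat \<times> nat \<Rightarrow> 'a" and B where *: "finite B" "1 \<in> span_over A v B"
    "\<And>w. w \<in> span_over A v B \<Longrightarrow> x * w \<in> span_over A v B"
    "\<And>w. w \<in> span_over A v B \<Longrightarrow> y * w \<in> span_over A v B"
    by (rule integral_over_common_span[OF assms], rule that)
  show ?thesis
  proof (rule integral_over_if_stable_span[OF A *(1,2)])
    fix b assume "b \<in> B"
    then show "(x * y) * v b \<in> span_over A v B"
      unfolding mult.assoc by (intro *(3,4) span_over_base[OF *(1)])
  qed
qed

lemma integral_over_power: "integral_over A x \<Longrightarrow> integral_over A (x ^ k)"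
  by (induction k) (auto intro: integral_over_mult integral_over_subring subring_one[OF A])

lemma integral_over_if_power:
  assumes "integral_over A (x ^ q)" "q > 0"
  shows "integral_over A x"
proof -
  obtain n c where c: "\<And>i. i < n \<Longrightarrow> c i \<in> A" and xn: "x ^ (q * n) = (\<Sum>i<n. c i * x ^ (q * i))"
    using assms(1) unfolding integral_over_def power_mult by blast
  let ?W = "span_over A (\<lambda>i. x ^ i) {..<q * n}"
  have base: "x ^ i \<in> ?W" if "i < q * n" for i
    using span_over_base[of "{..<q * n}" i "\<lambda>i. x ^ i"] that by simp
  have "n > 0" using xn by (auto intro!: gr0I)
  then have pos: "q * n > 0" using \<open>q > 0\<close> by simp
  have top: "x ^ (q * n) \<in> ?W"
    unfolding xn using \<open>q > 0\<close> by (intro span_over_sum span_over_scale c base) auto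
  show ?thesis
  proof (rule integral_over_if_stable_span[OF A])
    show "1 \<in> ?W" using base[OF pos] by simp
    fix i assume "i \<in> {..<q * n}"
    then have "Suc i < q * n \<or> Suc i = q * n" by auto
    then show "x * x ^ i \<in> ?W" using base[of "Suc i"] top by (metis power_Suc)
  qed simp
qed

end

section \<open>Powers of ideals and integral closure\<close>

lemma ideal_prod_memI: "a \<in> I \<Longrightarrow> b \<in> J \<Longrightarrow> a * b \<in> ideal_prod I J"
  unfolding ideal_prod_def by (intro ideal.span_base) blast

lemma ideal_prod_least:
  assumes "\<And>a b. a \<in> I \<Longrightarrow> b \<in> J \<Longrightarrow> a * b \<in> L" "ideal.subspace L"
  shows "ideal_prod I J \<subseteq> L"
  unfolding ideal_prod_def using assms by (intro ideal.span_minimal) auto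

lemma subspace_ideal_prod: "ideal.subspace (ideal_prod I J)"
  unfolding ideal_prod_def by (rule ideal.subspace_span)

lemma subspace_ideal_power: "ideal.subspace (ideal_power I n)"
  by (cases n) (auto simp: subspace_ideal_prod)

text \<open>Consequently an ideal multiplies \<open>S\<close> into \<open>L\<close> as soon as its generators
  do.\<close>

lemma subspace_multiplier:
  assumes "ideal.subspace L"
  shows "ideal.subspace {x. \<forall>y\<in>S. x * y \<in> L}"
  using assms unfolding ideal.subspace_def by (auto simp: distrib_right mult.assoc)

lemma ideal_power_mult:
  assumes "x \<in> ideal_power I a" "y \<in> ideal_power I b"
  shows "x * y \<in> ideal_power I (a + b)"
  using assms
proof (induction a arbitrary: x)
  case 0
  then show ?case by (simp add: ideal.subspace_scale[OF subspace_ideal_power])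
next
  case (Suc a)
  have "ideal_prod I (ideal_power I a) \<subseteq> {x. \<forall>y\<in>{y}. x * y \<in> ideal_power I (Suc a + b)}"
  proof (rule ideal_prod_least)
    fix u v assume "u \<in> I" "v \<in> ideal_power I a"
    then show "u * v \<in> {x. \<forall>y\<in>{y}. x * y \<in> ideal_power I (Suc a + b)}"
      using Suc.IH[of v] Suc.prems(2) by (auto simp: mult.assoc intro: ideal_prod_memI)
  qed (rule subspace_multiplier[OF subspace_ideal_power])
  then show ?case using Suc.prems(1) by auto
qed

lemma ideal_power_antimono:
  assumes "m \<le> n" shows "ideal_power I n \<subseteq> ideal_power I m"
proof (rule lift_Suc_antimono_le[OF _ assms])
  show "ideal_power I (Suc k) \<subseteq> ideal_power I k" for k
    by (simp, rule ideal_prod_least)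
      (auto intro: ideal.subspace_scale subspace_ideal_power)
qed

lemma ideal_prod_mono: "I \<subseteq> I' \<Longrightarrow> J \<subseteq> J' \<Longrightarrow> ideal_prod I J \<subseteq> ideal_prod I' J'"
  by (intro ideal_prod_least subspace_ideal_prod ideal_prod_memI) auto

lemma ideal_power_mono: "I \<subseteq> J \<Longrightarrow> ideal_power I n \<subseteq> ideal_power J n"
  by (induction n) (simp_all add: ideal_prod_mono)

lemma ideal_power_add: "ideal_power I (a + b) = ideal_prod (ideal_power I a) (ideal_power I b)"
proof
  show "ideal_power I (a + b) \<subseteq> ideal_prod (ideal_power I a) (ideal_power I b)"
  proof (induction a)
    case 0
    show ?case using ideal_prod_memI[of 1 UNIV _ "ideal_power I b"] by auto
  next
    case (Suc a)
    let ?P = "ideal_prod (ideal_power I (Suc a)) (ideal_power I b)"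
    have "u * w \<in> ?P" if "u \<in> I" "w \<in> ideal_power I (a + b)" for u w
    proof -
      have "ideal_prod (ideal_power I a) (ideal_power I b) \<subseteq> {x. \<forall>y\<in>{u}. x * y \<in> ?P}"
      proof (rule ideal_prod_least)
        fix x y assume "x \<in> ideal_power I a" "y \<in> ideal_power I b"
        then have "(u * x) * y \<in> ?P"
          using \<open>u \<in> I\<close> by (intro ideal_prod_memI) (auto intro: ideal_prod_memI)
        then show "x * y \<in> {x. \<forall>y\<in>{u}. x * y \<in> ?P}" by (simp add: mult_ac)
      qed (rule subspace_multiplier[OF subspace_ideal_prod])
      then show ?thesis using Suc that(2) by (auto simp: mult.commute)
    qed
    then have "ideal_prod I (ideal_power I (a + b)) \<subseteq> ?P"
      by (intro ideal_prod_least subspace_ideal_prod)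
    then show ?case by simp
  qed
  show "ideal_prod (ideal_power I a) (ideal_power I b) \<subseteq> ideal_power I (a + b)"
    by (intro ideal_prod_least subspace_ideal_power ideal_power_mult)
qed

lemma ideal_power_power: "ideal_power (ideal_power I p) i = ideal_power I (p * i)"
  by (induction i) (simp_all add: ideal_power_add)

text \<open>Writing the equation with ascending powers of \<open>f\<close> lets the weight \<open>n - i\<close>
  of a coefficient be read off from the power \<open>f\<^sup>i\<close> next to it.\<close>

lemma integral_closure_iff:
  "f \<in> integral_closure J \<longleftrightarrow>
    (\<exists>n c. (\<forall>i<n. c i \<in> ideal_power J (n - i)) \<and> f ^ n = (\<Sum>i<n. c i * f ^ i))"
  (is "_ \<longleftrightarrow> ?R")
proof
  have reindex: "(\<Sum>i=1..n. g i) = (\<Sum>i<n. g (n - i))" for n and g :: "nat \<Rightarrow> 'a"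
    by (rule sum.reindex_bij_witness[of _ "\<lambda>i. n - i" "\<lambda>i. n - i"]) auto
  {
    assume "f \<in> integral_closure J"
    then obtain n a where a: "\<And>i. i \<in> {1..n} \<Longrightarrow> a i \<in> ideal_power J i"
      and eq: "f ^ n + (\<Sum>i=1..n. a i * f ^ (n - i)) = 0"
      unfolding integral_closure_def by blast
    have "f ^ n = - (\<Sum>i<n. a (n - i) * f ^ (n - (n - i)))"
      using eq unfolding reindex by (simp add: eq_neg_iff_add_eq_0)
    also have "\<dots> = (\<Sum>i<n. - a (n - i) * f ^ i)"
      unfolding sum_negf[symmetric] by (rule sum.cong) auto
    finally show ?R
      by (intro exI[of _ n] exI[of _ "\<lambda>i. - a (n - i)"])
        (auto intro!: ideal.subspace_neg[OF subspace_ideal_power] a)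
  }
  {
    assume ?R
    then obtain n c where c: "\<And>i. i < n \<Longrightarrow> c i \<in> ideal_power J (n - i)"
      and eq: "f ^ n = (\<Sum>i<n. c i * f ^ i)" by blast
    have "n \<ge> 1" using eq by (cases n) auto
    moreover have "f ^ n + (\<Sum>i=1..n. - c (n - i) * f ^ (n - i)) = 0"
      unfolding reindex eq sum.distrib[symmetric] by (rule sum.neutral) auto
    moreover have "- c (n - i) \<in> ideal_power J i" if "i \<in> {1..n}" for i
      using that c[of "n - i"] by (auto intro!: ideal.subspace_neg[OF subspace_ideal_power])
    ultimately show "f \<in> integral_closure J"
      unfolding integral_closure_def mem_Collect_eq
      by (intro exI[of _ n] exI[of _ "\<lambda>i. - c (n - i)"]) auto
  }
qed

lemma integral_closure_mono:
  assumes "I \<subseteq> J" shows "integral_closure I \<subseteq> integral_closure J"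
  unfolding integral_closure_def using ideal_power_mono[OF assms] by blast

section \<open>Fractional powers of an ideal\<close>

text \<open>The rational power with exponent \<open>p / q\<close>. Keeping numerator and denominator apart gives
  all powers that occur below the same denominator \<open>q\<close>.\<close>

definition fractional_power :: "'a::comm_ring_1 set \<Rightarrow> nat \<Rightarrow> nat \<Rightarrow> 'a set" where
  "fractional_power I p q = {f. f ^ q \<in> integral_closure (ideal_power I p)}"

lemma fractional_power_equation:
  "f \<in> fractional_power I p q \<longleftrightarrow>
    (\<exists>n c. (\<forall>i<n. c i \<in> ideal_power I (p * (n - i))) \<and> f ^ (q * n) = (\<Sum>i<n. c i * f ^ (q * i)))"
  by (simp add: fractional_power_def integral_closure_iff ideal_power_power power_mult)

text \<open>For \<open>q > 0\<close> this is the power of \<open>I\<close> with exponent \<open>j / q\<close>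
  rounded up; the existential quantifier avoids computing with the rounding.\<close>

definition rees_piece :: "'a::comm_ring_1 set \<Rightarrow> nat \<Rightarrow> nat \<Rightarrow> 'a set" where
  "rees_piece I q j = {x. \<exists>m. j \<le> q * m \<and> x \<in> ideal_power I m}"

text \<open>The Rees algebra of \<open>I\<close> for the filtration by fractional exponents: the variable has
  weight \<open>1 / q\<close>, so the coefficient of its \<open>j\<close>-th power is required to lie in the
  power of \<open>I\<close> with exponent \<open>j / q\<close>.\<close>

definition rees :: "'a::comm_ring_1 set \<Rightarrow> nat \<Rightarrow> 'a poly set" where
  "rees I q = {F. \<forall>j. coeff F j \<in> rees_piece I q j}"

lemma rees_iff: "F \<in> rees I q \<longleftrightarrow> (\<forall>j. coeff F j \<in> rees_piece I q j)"
  by (simp add: rees_def)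

context
  fixes q :: nat and I :: "'a::comm_ring_1 set"
  assumes q: "q > 0"
begin

lemma rees_piece_0: "0 \<in> rees_piece I q j"
  using q ideal.subspace_0[OF subspace_ideal_power] by (auto simp: rees_piece_def intro!: exI[of _ j])

lemma rees_piece_diff:
  assumes "x \<in> rees_piece I q j" "y \<in> rees_piece I q j"
  shows "x - y \<in> rees_piece I q j"
proof -
  obtain m m' where m: "j \<le> q * m" "x \<in> ideal_power I m"
    and m': "j \<le> q * m'" "y \<in> ideal_power I m'"
    using assms unfolding rees_piece_def by blast
  have "x - y \<in> ideal_power I (min m m')"
    using ideal_power_antimono[of "min m m'" m I] ideal_power_antimono[of "min m m'" m' I] m(2) m'(2)
    by (intro ideal.subspace_diff subspace_ideal_power) auto
  then show ?thesis
    using m(1) m'(1) unfolding rees_piece_def by (auto intro!: exI[of _ "min m m'"] simp: min_def)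
qed

lemma rees_piece_sum: "(\<And>i. i \<in> S \<Longrightarrow> f i \<in> rees_piece I q j) \<Longrightarrow> sum f S \<in> rees_piece I q j"
proof (induction S rule: infinite_finite_induct)
  case (insert x S)
  then show ?case
    using rees_piece_diff[of "f x" j "- sum f S"] rees_piece_diff[of 0 j "sum f S"] rees_piece_0
    by auto
qed (auto simp: rees_piece_0)

lemma rees_piece_mult:
  assumes "x \<in> rees_piece I q i" "y \<in> rees_piece I q j"
  shows "x * y \<in> rees_piece I q (i + j)"
proof -
  obtain m m' where m: "i \<le> q * m" "x \<in> ideal_power I m"
    and m': "j \<le> q * m'" "y \<in> ideal_power I m'"
    using assms unfolding rees_piece_def by blast
  have "i + j \<le> q * (m + m')" using m(1) m'(1) by (simp add: distrib_left)
  then show ?thesis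
    using ideal_power_mult[OF m(2) m'(2)] unfolding rees_piece_def by blast
qed

lemma rees_piece_multiple: "rees_piece I q (q * i) = ideal_power I i"
  unfolding rees_piece_def using q ideal_power_antimono by fastforce

lemma is_subring_rees: "is_subring (rees I q)"
  unfolding is_subring_def
proof (intro conjI ballI)
  show "1 \<in> rees I q"
    using rees_piece_multiple[of 0] rees_piece_0
    by (auto simp: rees_iff one_pCons coeff_pCons split: nat.split)
  fix F G assume F: "F \<in> rees I q" and G: "G \<in> rees I q"
  show "F - G \<in> rees I q"
    using F G by (auto simp: rees_iff intro: rees_piece_diff)
  have "coeff F i * coeff G (j - i) \<in> rees_piece I q j" if "i \<le> j" for i j
    using rees_piece_mult[of "coeff F i" i "coeff G (j - i)" "j - i"] F G that
    by (simp add: rees_iff)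
  then show "F * G \<in> rees I q"
    by (auto simp: rees_iff coeff_mult intro!: rees_piece_sum)
qed

lemma monom_in_rees: "x \<in> rees_piece I q j \<Longrightarrow> monom x j \<in> rees I q"
  by (simp add: rees_iff rees_piece_0)

text \<open>An integral equation for \<open>f\<^sup>q\<close> over \<open>I\<^sup>p\<close> becomes homogeneous
  when \<open>f\<close> is replaced by \<open>f s\<^sup>p\<close> and the coefficients are multiplied by
  suitable powers of \<open>s\<close>. Conversely, given an equation over \<open>rees I q\<close> that need not
  be homogeneous, its component in the degree of the leading term is an equation of the required kind. Only in
  degrees divisible by \<open>q\<close> are the graded pieces given by unrounded exponents, whence the passage
  through the \<open>q\<close>-th power of \<open>f s\<^sup>p\<close> in both directions.\<close>

lemma fractional_power_iff_integral:
  "f \<in> fractional_power I p q \<longleftrightarrow> integral_over (rees I q) (monom f p)"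
proof
  assume "f \<in> fractional_power I p q"
  then obtain n c where c: "\<And>i. i < n \<Longrightarrow> c i \<in> ideal_power I (p * (n - i))"
    and eq: "f ^ (q * n) = (\<Sum>i<n. c i * f ^ (q * i))"
    unfolding fractional_power_equation by blast
  have "integral_over (rees I q) (monom f p ^ q)"
    unfolding integral_over_def
  proof (intro exI conjI allI impI)
    show "monom (c i) (q * (p * (n - i))) \<in> rees I q" if "i < n" for i
      using c[OF that] by (intro monom_in_rees) (simp add: rees_piece_multiple)
    have "(monom f p ^ q) ^ n = monom (f ^ (q * n)) (p * q * n)"
      by (simp add: monom_power power_mult)
    also have "\<dots> = (\<Sum>i<n. monom (c i * f ^ (q * i)) (p * q * n))"
      unfolding eq by (rule poly_eqI) (simp add: coeff_sum)
    also have "\<dots> = (\<Sum>i<n. monom (c i) (q * (p * (n - i))) * (monom f p ^ q) ^ i)"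
    proof (rule sum.cong)
      fix i assume "i \<in> {..<n}"
      then have "q * (p * (n - i)) + p * q * i = p * q * n"
        by (auto simp: mult.left_commute mult.assoc distrib_left[symmetric])
      then show "monom (c i * f ^ (q * i)) (p * q * n)
          = monom (c i) (q * (p * (n - i))) * (monom f p ^ q) ^ i"
        by (simp add: monom_power mult_monom power_mult)
    qed simp
    finally show "(monom f p ^ q) ^ n
        = (\<Sum>i<n. monom (c i) (q * (p * (n - i))) * (monom f p ^ q) ^ i)" .
  qed
  then show "integral_over (rees I q) (monom f p)"
    using q by (rule integral_over_if_power[OF is_subring_rees])
next
  assume "integral_over (rees I q) (monom f p)"
  then have "integral_over (rees I q) (monom f p ^ q)"
    by (rule integral_over_power[OF is_subring_rees])
  then obtain n C where C: "\<And>i. i < n \<Longrightarrow> C i \<in> rees I q"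
    and eq: "(monom f p ^ q) ^ n = (\<Sum>i<n. C i * (monom f p ^ q) ^ i)"
    unfolding integral_over_def by blast
  let ?c = "\<lambda>i. coeff (C i) (q * (p * (n - i)))"
  have "f ^ (q * n) = coeff ((monom f p ^ q) ^ n) (p * q * n)"
    by (simp add: monom_power power_mult)
  also have "\<dots> = (\<Sum>i<n. coeff (monom (f ^ (q * i)) (p * q * i) * C i) (p * q * n))"
    unfolding eq coeff_sum by (rule sum.cong)
      (simp_all add: monom_power power_mult[symmetric] mult.commute[of "C _"] mult.assoc)
  also have "\<dots> = (\<Sum>i<n. ?c i * f ^ (q * i))"
  proof (rule sum.cong)
    fix i assume "i \<in> {..<n}"
    then have "p * q * n = q * (p * (n - i)) + p * q * i"
      by (auto simp: mult.left_commute mult.assoc distrib_left[symmetric])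
    then show "coeff (monom (f ^ (q * i)) (p * q * i) * C i) (p * q * n) = ?c i * f ^ (q * i)"
      by (simp add: coeff_monom_mult mult.commute[of "coeff _ _"])
  qed simp
  finally have "f ^ (q * n) = (\<Sum>i<n. ?c i * f ^ (q * i))" .
  moreover have "?c i \<in> ideal_power I (p * (n - i))" if "i < n" for i
    using C[OF that] rees_iff rees_piece_multiple by metis
  ultimately show "f \<in> fractional_power I p q"
    unfolding fractional_power_equation by (intro exI[of _ n] exI[of _ ?c]) simp
qed

lemma subspace_fractional_power: "ideal.subspace (fractional_power I p q)"
  unfolding ideal.subspace_def fractional_power_iff_integral
proof (intro conjI ballI allI)
  show "integral_over (rees I q) (monom 0 p)"
    using subring_zero[OF is_subring_rees]
    by (auto intro: integral_over_subring[OF is_subring_rees])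
next
  fix f g assume "f \<in> fractional_power I p q" "g \<in> fractional_power I p q"
  then show "integral_over (rees I q) (monom (f + g) p)"
    unfolding fractional_power_iff_integral add_monom[symmetric]
    by (rule integral_over_add[OF is_subring_rees])
next
  fix c f assume f: "f \<in> fractional_power I p q"
  have "monom c 0 \<in> rees I q"
    using rees_piece_multiple[of 0] by (intro monom_in_rees) simp
  then have "integral_over (rees I q) (monom c 0 * monom f p)"
    using f unfolding fractional_power_iff_integral
    by (rule integral_over_mult[OF is_subring_rees integral_over_subring[OF is_subring_rees]])
  then show "integral_over (rees I q) (monom (c * f) p)"
    by (simp add: mult_monom)
qed

lemma fractional_power_mult:
  assumes "f \<in> fractional_power I a q" "g \<in> fractional_power I b q"
  shows "f * g \<in> fractional_power I (a + b) q"
  using integral_over_mult[OF is_subring_rees, of "monom f a" "monom g b"] assms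
  unfolding fractional_power_iff_integral by (simp add: mult_monom)

end

lemma fractional_power_antimono:
  assumes "b \<le> a" shows "fractional_power I a q \<subseteq> fractional_power I b q"
  unfolding fractional_power_def
  using integral_closure_mono[OF ideal_power_antimono[OF assms]] by blast

section \<open>Extracting terms by scaling\<close>

text \<open>Invertibility of a Vandermonde matrix, in a form that uses only division by positive integers: from
  the combinations \<open>c k\<close> of \<open>x 0, \<dots>, x N\<close> with ratio \<open>2\<^sup>k\<close>,
  the difference \<open>2\<^sup>N c k - c (k + 1)\<close> eliminates the last term and multiplies each other
  \<open>x j\<close> by the positive integer \<open>2\<^sup>N - 2\<^sup>j\<close>.\<close>

lemma mem_if_geometric_combinations_mem:
  fixes x :: "nat \<Rightarrow> 'a::comm_ring_1"
  assumes V: "ideal.subspace V"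
    and divisible: "\<And>n y. n > 0 \<Longrightarrow> of_nat n * y \<in> V \<Longrightarrow> y \<in> V"
    and "\<And>k. (\<Sum>j<N. (2 ^ k) ^ j * x j) \<in> V" and "j < N"
  shows "x j \<in> V"
  using assms(3,4)
proof (induction N arbitrary: x j)
  case (Suc N)
  have below: "x j \<in> V" if "j < N" for j
  proof -
    have "(\<Sum>j<N. (2 ^ k) ^ j * (of_nat (2 ^ N - 2 ^ j) * x j)) \<in> V" for k
    proof -
      have "(\<Sum>j<N. (2 ^ k) ^ j * (of_nat (2 ^ N - 2 ^ j) * x j))
          = (\<Sum>j<N. 2 ^ N * ((2 ^ k) ^ j * x j) - (2 ^ Suc k) ^ j * x j)"
      proof (rule sum.cong)
        fix j assume "j \<in> {..<N}"
        then have diff: "(of_nat (2 ^ N - 2 ^ j) :: 'a) = 2 ^ N - 2 ^ j"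
          by (simp add: of_nat_diff power_increasing)
        show "(2 ^ k) ^ j * (of_nat (2 ^ N - 2 ^ j) * x j)
            = 2 ^ N * ((2 ^ k) ^ j * x j) - (2 ^ Suc k) ^ j * x j"
          unfolding diff by (simp add: algebra_simps power_mult_distrib)
      qed simp
      also have "\<dots> = 2 ^ N * (\<Sum>j<Suc N. (2 ^ k) ^ j * x j) - (\<Sum>j<Suc N. (2 ^ Suc k) ^ j * x j)"
        by (simp add: sum_subtractf sum_distrib_left distrib_left power_mult_distrib mult.assoc)
      also have "\<dots> \<in> V"
        by (intro ideal.subspace_diff ideal.subspace_scale V Suc.prems(1))
      finally show ?thesis .
    qed
    from Suc.IH[OF this \<open>j < N\<close>] show ?thesis
      using divisible[of "2 ^ N - 2 ^ j"] \<open>j < N\<close> by (simp add: power_strict_increasing)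
  qed
  show ?case
  proof (cases "j = N")
    case True
    have "x N = (\<Sum>j<Suc N. (2 ^ 0) ^ j * x j) - (\<Sum>j<N. x j)" by simp
    also have "\<dots> \<in> V"
      by (intro ideal.subspace_diff V Suc.prems(1) ideal.subspace_sum) (auto intro: below)
    finally show ?thesis using True by simp
  next
    case False
    then show ?thesis using below Suc.prems(2) by simp
  qed
qed simp

section \<open>First-order Taylor coefficients of elements of fractional powers\<close>

lemma subspace_vimage:
  assumes "comm_ring_hom h" "ideal.subspace L"
  shows "ideal.subspace {x. h x \<in> L}"
proof -
  interpret comm_ring_hom h by fact
  show ?thesis using assms(2) by (simp add: ideal.subspace_def hom_add hom_mult)
qed

lemma ideal_power_hom:
  assumes h: "comm_ring_hom h" and IK: "h ` I \<subseteq> K" and "x \<in> ideal_power I n"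
  shows "h x \<in> ideal_power K n"
  using assms(3)
proof (induction n arbitrary: x)
  case (Suc n)
  interpret comm_ring_hom h by fact
  have "ideal_prod I (ideal_power I n) \<subseteq> {x. h x \<in> ideal_power K (Suc n)}"
    by (rule ideal_prod_least[OF _ subspace_vimage[OF h subspace_ideal_power]])
      (use IK Suc.IH in \<open>auto simp: hom_mult intro!: ideal_prod_memI\<close>)
  then show ?case using Suc.prems by auto
qed simp

lemma fractional_power_hom:
  assumes h: "comm_ring_hom h" and IK: "h ` I \<subseteq> K" and "f \<in> fractional_power I p q"
  shows "h f \<in> fractional_power K p q"
proof -
  interpret comm_ring_hom h by fact
  obtain n c where c: "\<And>i. i < n \<Longrightarrow> c i \<in> ideal_power I (p * (n - i))"
    and eq: "f ^ (q * n) = (\<Sum>i<n. c i * f ^ (q * i))"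
    using assms(3) unfolding fractional_power_equation by blast
  have "h f ^ (q * n) = (\<Sum>i<n. h (c i) * h f ^ (q * i))"
    using arg_cong[OF eq, of h] by (simp add: hom_sum hom_mult hom_power)
  then show ?thesis
    unfolding fractional_power_equation
    by (intro exI[of _ n] exI[of _ "\<lambda>i. h (c i)"]) (simp add: ideal_power_hom[OF h IK] c)
qed

text \<open>The ideal of \<open>R[t]\<close> generated by \<open>I\<close> and \<open>t\<close>, for an ideal
  \<open>I\<close> of \<open>R\<close>.\<close>

definition ideal_plus_var :: "'a::comm_ring_1 set \<Rightarrow> 'a poly set" where
  "ideal_plus_var I = {F. coeff F 0 \<in> I}"

text \<open>A product of \<open>n\<close> elements of \<open>I + (t)\<close> reaches the monomial
  \<open>t\<^sup>l\<close> with at most \<open>l\<close> factors \<open>t\<close>, and each remaining factor is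
  taken from \<open>I\<close>.\<close>

lemma coeff_ideal_plus_var_power:
  assumes "F \<in> ideal_power (ideal_plus_var I) n"
  shows "coeff F l \<in> ideal_power I (n - l)"
  using assms
proof (induction n arbitrary: F l)
  case (Suc n)
  let ?L = "{F :: 'a poly. \<forall>l. coeff F l \<in> ideal_power I (Suc n - l)}"
  have le: "x \<in> ideal_power I a \<Longrightarrow> b \<le> a \<Longrightarrow> x \<in> ideal_power I b" for x a b
    using ideal_power_antimono by blast
  have "ideal.subspace ?L"
    unfolding ideal.subspace_def
  proof (intro conjI ballI allI)
    show "0 \<in> ?L" by (auto intro: ideal.subspace_0[OF subspace_ideal_power])
    fix F G assume "F \<in> ?L"
    then have F: "coeff F l \<in> ideal_power I (Suc n - l)" for l by blast
    show "F + G \<in> ?L" if "G \<in> ?L"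
      using that F by (auto intro: ideal.subspace_add[OF subspace_ideal_power])
    show "C * F \<in> ?L" for C
      by (auto simp: coeff_mult intro!: ideal.subspace_sum[OF subspace_ideal_power]
          ideal.subspace_scale[OF subspace_ideal_power] le[OF F])
  qed
  moreover have "F * G \<in> ?L" if "F \<in> ideal_plus_var I" "G \<in> ideal_power (ideal_plus_var I) n" for F G
  proof -
    have "coeff F i * coeff G (l - i) \<in> ideal_power I (Suc n - l)" if "i \<le> l" for i l
    proof (cases i)
      case 0
      have "coeff F 0 * coeff G l \<in> ideal_power I (Suc (n - l))"
        using \<open>F \<in> ideal_plus_var I\<close> Suc.IH[OF \<open>G \<in> _\<close>]
        by (auto simp: ideal_plus_var_def intro: ideal_prod_memI)
      from le[OF this, of "Suc n - l"] show ?thesis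
        using 0 by (simp del: ideal_power.simps)
    next
      case (Suc i')
      then show ?thesis
        using that by (intro ideal.subspace_scale[OF subspace_ideal_power]
            le[OF Suc.IH[OF \<open>G \<in> _\<close>]]) auto
    qed
    then show ?thesis
      by (auto simp: coeff_mult intro!: ideal.subspace_sum[OF subspace_ideal_power])
  qed
  ultimately have "ideal_prod (ideal_plus_var I) (ideal_power (ideal_plus_var I) n) \<subseteq> ?L"
    by (intro ideal_prod_least)
  then show ?case using Suc.prems by auto
qed simp

lemma comm_ring_hom_pcompose: "comm_ring_hom (\<lambda>F :: 'a::comm_ring_1 poly. pcompose F G)"
  by unfold_locales (simp_all add: pcompose_add pcompose_mult pcompose_1)

lemma divisible_if_rational:
  assumes "\<And>n. n > 0 \<Longrightarrow> \<exists>c::'a::comm_ring_1. of_nat n * c = 1"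
    and V: "ideal.subspace (V :: 'a set)" and "n > 0" "of_nat n * y \<in> V"
  shows "y \<in> V"
proof -
  obtain c :: 'a where "of_nat n * c = 1" using assms(1)[OF \<open>n > 0\<close>] by blast
  then have "y = c * (of_nat n * y)" by (metis mult.assoc mult.commute mult_1)
  then show ?thesis using ideal.subspace_scale[OF V assms(4)] by metis
qed

text \<open>The substitutions \<open>t \<mapsto> 2\<^sup>k t\<close> preserve \<open>I + (t)\<close>, hence its
  fractional powers, and they scale the term of degree \<open>j\<close> by
  \<open>(2\<^sup>k)\<^sup>j\<close>.\<close>

lemma monom_coeff_in_fractional_power_ideal_plus_var:
  fixes F :: "'a::comm_ring_1 poly"
  assumes rat: "\<And>n. n > 0 \<Longrightarrow> \<exists>c::'a. of_nat n * c = 1"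
    and q: "q > 0" and F: "F \<in> fractional_power (ideal_plus_var I) p q"
  shows "monom (coeff F j) j \<in> fractional_power (ideal_plus_var I) p q"
proof (rule mem_if_geometric_combinations_mem[where N = "Suc (max j (degree F))"])
  let ?V = "fractional_power (ideal_plus_var I) p q"
  show V: "ideal.subspace ?V" by (rule subspace_fractional_power[OF q])
  show "G \<in> ?V" if n: "n > 0" and G: "of_nat n * G \<in> ?V" for n and G :: "'a poly"
  proof (rule divisible_if_rational[OF _ V n G])
    fix n :: nat assume "n > 0"
    then obtain c :: 'a where "of_nat n * c = 1" using rat by blast
    then have "of_nat n * [:c:] = 1" by (simp add: of_nat_poly one_pCons mult.commute)
    then show "\<exists>c :: 'a poly. of_nat n * c = 1" ..
  qed
  fix k
  have "(\<Sum>j<Suc (max j (degree F)). (2 ^ k) ^ j * monom (coeff F j) j) = pcompose F [:0, 2 ^ k:]"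
  proof (rule poly_eqI)
    fix l
    have "((2 :: 'a poly) ^ k) ^ i = [:(2 ^ k) ^ i:]" for i
      by (metis of_nat_poly of_nat_power of_nat_numeral)
    then have two: "(2 ^ k) ^ i * G = Polynomial.smult ((2 ^ k) ^ i) G" for i and G :: "'a poly"
      by simp
    show "coeff (\<Sum>j<Suc (max j (degree F)). (2 ^ k) ^ j * monom (coeff F j) j) l
        = coeff (pcompose F [:0, 2 ^ k:]) l"
      using coeff_eq_0[of F l]
      by (auto simp: coeff_sum two coeff_pcompose_linear if_distrib cong: if_cong)
  qed
  also have "\<dots> \<in> ?V"
  proof (rule fractional_power_hom[OF comm_ring_hom_pcompose _ F])
    show "(\<lambda>F. pcompose F [:0, 2 ^ k:]) ` ideal_plus_var I \<subseteq> ideal_plus_var I"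
      by (auto simp: ideal_plus_var_def poly_0_coeff_0)
  qed
  finally show "(\<Sum>j<Suc (max j (degree F)). (2 ^ k) ^ j * monom (coeff F j) j) \<in> ?V" .
qed simp

text \<open>In an equation of degree \<open>n\<close> for \<open>(g t)\<^sup>q\<close>, the coefficient of
  \<open>t\<close> to the power \<open>q n\<close> keeps from \<open>C i\<close> only the term with \<open>q (n
  - i)\<close> factors \<open>t\<close>. By the preceding estimate it lies in the power of \<open>I\<close> with
  exponent \<open>p (n - i) - q (n - i)\<close>.\<close>

lemma fractional_power_if_monom_1:
  assumes "monom g 1 \<in> fractional_power (ideal_plus_var I) p q" "q \<le> p"
  shows "g \<in> fractional_power I (p - q) q"
proof -
  obtain n C where C: "\<And>i. i < n \<Longrightarrow> C i \<in> ideal_power (ideal_plus_var I) (p * (n - i))"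
    and eq: "monom g 1 ^ (q * n) = (\<Sum>i<n. C i * monom g 1 ^ (q * i))"
    using assms(1) unfolding fractional_power_equation by blast
  let ?c = "\<lambda>i. coeff (C i) (q * (n - i))"
  have "g ^ (q * n) = coeff (monom g 1 ^ (q * n)) (q * n)"
    by (simp add: monom_power)
  also have "\<dots> = (\<Sum>i<n. coeff (monom (g ^ (q * i)) (q * i) * C i) (q * n))"
    unfolding eq coeff_sum by (simp add: monom_power mult.commute[of "C _"])
  also have "\<dots> = (\<Sum>i<n. ?c i * g ^ (q * i))"
    by (rule sum.cong) (auto simp: coeff_monom_mult right_diff_distrib' mult.commute[of "coeff _ _"])
  finally have "g ^ (q * n) = (\<Sum>i<n. ?c i * g ^ (q * i))" .
  moreover have "?c i \<in> ideal_power I ((p - q) * (n - i))" if "i < n" for i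
    using coeff_ideal_plus_var_power[OF C[OF that], of "q * (n - i)"]
    by (simp add: left_diff_distrib')
  ultimately show ?thesis
    unfolding fractional_power_equation by (intro exI[of _ n] exI[of _ ?c]) auto
qed

text \<open>Here \<open>\<phi>\<close> plays the role of a Taylor expansion \<open>f + t \<partial>f +
  \<dots>\<close>. All higher terms are needed: modulo \<open>t\<^sup>2\<close> the variable would be nilpotent
  and thus integral over every ideal, and the exponent of \<open>t\<close> would carry no information.\<close>

lemma first_order_coeff_in_fractional_power:
  fixes \<phi> :: "'a::comm_ring_1 \<Rightarrow> 'a poly"
  assumes rat: "\<And>n. n > 0 \<Longrightarrow> \<exists>c::'a. of_nat n * c = 1"
    and hom: "comm_ring_hom \<phi>" and coeff_0: "\<And>f. coeff (\<phi> f) 0 = f"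
    and q: "0 < q" "q \<le> p" and f: "f \<in> fractional_power I p q"
  shows "coeff (\<phi> f) 1 \<in> fractional_power I (p - q) q"
proof -
  have "\<phi> ` I \<subseteq> ideal_plus_var I" by (auto simp: ideal_plus_var_def coeff_0)
  from fractional_power_hom[OF hom this f]
  have "\<phi> f \<in> fractional_power (ideal_plus_var I) p q" .
  then show ?thesis
    using monom_coeff_in_fractional_power_ideal_plus_var[OF rat q(1)] fractional_power_if_monom_1 q(2)
    by blast
qed

section \<open>Taylor expansion of polynomials in one variable direction\<close>

text \<open>The universal map out of a monoid ring, determined by the images of coefficients and of
  monomials.\<close>

definition monoid_ring_lift ::
    "('k::comm_ring_1 \<Rightarrow> 'b::comm_ring_1) \<Rightarrow> ('m::comm_monoid_add \<Rightarrow> 'b) \<Rightarrow> ('m \<Rightarrow>\<^sub>0 'k) \<Rightarrow> 'b" where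
  "monoid_ring_lift \<iota> e f = (\<Sum>m\<in>Poly_Mapping.keys f. \<iota> (Poly_Mapping.lookup f m) * e m)"

lemma sum_single_lookup:
  fixes f :: "'m \<Rightarrow>\<^sub>0 'k::comm_monoid_add"
  shows
  "(\<Sum>m\<in>Poly_Mapping.keys f. Poly_Mapping.single m (Poly_Mapping.lookup f m)) = f"
  by (rule poly_mapping_eqI)
    (auto simp: lookup_sum lookup_single when_def in_keys_iff)

lemma poly_mapping_additive_induct:
  fixes f :: "'m \<Rightarrow>\<^sub>0 'k::comm_monoid_add"
  assumes "P 0" "\<And>m c. P (Poly_Mapping.single m c)" "\<And>f g. P f \<Longrightarrow> P g \<Longrightarrow> P (f + g)"
  shows "P f"
proof -
  have "P (\<Sum>m\<in>S. Poly_Mapping.single m (Poly_Mapping.lookup f m))" for S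
    by (induction S rule: infinite_finite_induct) (auto intro: assms)
  then show ?thesis by (metis sum_single_lookup)
qed

context
  fixes \<iota> :: "'k::comm_ring_1 \<Rightarrow> 'b::comm_ring_1" and e :: "'m::comm_monoid_add \<Rightarrow> 'b"
  assumes \<iota>: "comm_ring_hom \<iota>" and e_0: "e 0 = 1" and e_add: "\<And>m n. e (m + n) = e m * e n"
begin

interpretation \<iota>: comm_ring_hom \<iota> by (rule \<iota>)

lemma monoid_ring_lift_single: "monoid_ring_lift \<iota> e (Poly_Mapping.single m c) = \<iota> c * e m"
  by (simp add: monoid_ring_lift_def)

lemma monoid_ring_lift_add:
  "monoid_ring_lift \<iota> e (f + g) = monoid_ring_lift \<iota> e f + monoid_ring_lift \<iota> e g"
  unfolding monoid_ring_lift_def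
  by (rule setsum_keys_plus_distrib) (simp_all add: \<iota>.hom_add distrib_right)

lemma monoid_ring_lift_mult:
  "monoid_ring_lift \<iota> e (f * g) = monoid_ring_lift \<iota> e f * monoid_ring_lift \<iota> e g"
proof (induction f rule: poly_mapping_additive_induct)
  case (2 m c)
  show ?case
  proof (induction g rule: poly_mapping_additive_induct)
    case (2 n d)
    show ?case
      by (simp add: mult_single monoid_ring_lift_single e_add \<iota>.hom_mult mult_ac)
  qed (simp add: monoid_ring_lift_def, simp add: distrib_left monoid_ring_lift_add)
qed (simp add: monoid_ring_lift_def, simp add: distrib_right monoid_ring_lift_add)

lemma comm_ring_hom_monoid_ring_lift: "comm_ring_hom (monoid_ring_lift \<iota> e)"
proof unfold_locales
  show "monoid_ring_lift \<iota> e 1 = 1"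
    using monoid_ring_lift_single[of 0 1] by (simp add: e_0)
qed (simp_all add: monoid_ring_lift_add monoid_ring_lift_mult, simp add: monoid_ring_lift_def)

end

lemma comm_ring_hom_const: "comm_ring_hom (Poly_Mapping.single (0 :: 'm::comm_monoid_add) :: 'k::comm_ring_1 \<Rightarrow> _)"
  by unfold_locales (simp_all add: single_add mult_single)

text \<open>The substitution \<open>x\<^sub>i \<mapsto> x\<^sub>i + t\<close>: a monomial \<open>m\<close> is
  split into its part free of \<open>x\<^sub>i\<close> and a power of \<open>x\<^sub>i\<close>.\<close>

definition taylor :: "'n \<Rightarrow> ('n, 'k::comm_ring_1) mpoly \<Rightarrow> ('n, 'k) mpoly poly" where
  "taylor i = monoid_ring_lift (\<lambda>c. [:Poly_Mapping.single 0 c:])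
    (\<lambda>m. [:Poly_Mapping.single (m - Poly_Mapping.single i (Poly_Mapping.lookup m i)) 1:]
      * [:Poly_Mapping.single (Poly_Mapping.single i 1) 1, 1:] ^ Poly_Mapping.lookup m i)"

lemma comm_ring_hom_taylor: "comm_ring_hom (taylor i :: ('n, 'k::comm_ring_1) mpoly \<Rightarrow> _)"
  unfolding taylor_def
proof (rule comm_ring_hom_monoid_ring_lift)
  interpret comm_ring_hom "Poly_Mapping.single 0 :: 'k \<Rightarrow> ('n, 'k) mpoly"
    by (rule comm_ring_hom_const)
  show "comm_ring_hom (\<lambda>c :: 'k. [:Poly_Mapping.single 0 c :: ('n, 'k) mpoly:])"
    by unfold_locales (simp_all add: hom_add hom_mult one_pCons)
  have "(m + n) - Poly_Mapping.single i (Poly_Mapping.lookup (m + n) i)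
      = (m - Poly_Mapping.single i (Poly_Mapping.lookup m i))
        + (n - Poly_Mapping.single i (Poly_Mapping.lookup n i))" for m n :: "'n \<Rightarrow>\<^sub>0 nat"
    by (rule poly_mapping_eqI) (simp add: lookup_add lookup_minus lookup_single when_def)
  then show "[:Poly_Mapping.single ((m + n) - Poly_Mapping.single i (Poly_Mapping.lookup (m + n) i)) 1:]
        * [:Poly_Mapping.single (Poly_Mapping.single i 1) 1, 1:] ^ Poly_Mapping.lookup (m + n) i
      = [:Poly_Mapping.single (m - Poly_Mapping.single i (Poly_Mapping.lookup m i)) 1:]
          * [:Poly_Mapping.single (Poly_Mapping.single i 1) 1, 1:] ^ Poly_Mapping.lookup m i
        * ([:Poly_Mapping.single (n - Poly_Mapping.single i (Poly_Mapping.lookup n i)) 1 :: ('n, 'k) mpoly:]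
          * [:Poly_Mapping.single (Poly_Mapping.single i 1) 1, 1:] ^ Poly_Mapping.lookup n i)"
    for m n :: "'n \<Rightarrow>\<^sub>0 nat"
    using mult_single[where ?'a = "'n \<Rightarrow>\<^sub>0 nat" and a = "1 :: 'k" and b = 1]
    by (simp add: lookup_add power_add mult_smult_left mult_smult_right del: One_nat_def)
      (simp add: add.commute)
qed (simp add: one_pCons)

lemma coeff_0_linear_power: "coeff ([:a, 1:] ^ k) 0 = (a :: 'a::comm_ring_1) ^ k"
  by (simp add: poly_0_coeff_0[symmetric] poly_power)

lemma coeff_1_linear_power: "coeff ([:a, 1:] ^ k) 1 = of_nat k * (a :: 'a::comm_ring_1) ^ (k - 1)"
proof (induction k)
  case (Suc k)
  have "coeff ([:a, 1:] ^ Suc k) 1 = a * coeff ([:a, 1:] ^ k) 1 + a ^ k"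
    by (simp add: coeff_0_linear_power)
  also have "\<dots> = of_nat (Suc k) * a ^ k"
    unfolding Suc.IH by (cases k) (simp_all add: algebra_simps)
  finally show ?case by simp
qed simp

lemma variable_power:
  "Poly_Mapping.single (Poly_Mapping.single i 1) (1 :: 'k::comm_ring_1) ^ k
    = (Poly_Mapping.single (Poly_Mapping.single i k) 1 :: ('n, 'k) mpoly)"
  by (induction k) (simp_all add: mult_single single_add[symmetric])

lemma coeff_0_taylor: "coeff (taylor i f) 0 = f"
proof -
  have "Poly_Mapping.single 0 c * (Poly_Mapping.single (m - Poly_Mapping.single i (Poly_Mapping.lookup m i)) 1
      * Poly_Mapping.single (Poly_Mapping.single i (Poly_Mapping.lookup m i)) 1) = Poly_Mapping.single m c"
    for m :: "'a \<Rightarrow>\<^sub>0 nat" and c :: 'b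
  proof -
    have "m - Poly_Mapping.single i (Poly_Mapping.lookup m i)
        + Poly_Mapping.single i (Poly_Mapping.lookup m i) = m"
      by (rule poly_mapping_eqI) (simp add: lookup_add lookup_minus lookup_single when_def)
    then show ?thesis by (simp add: mult_single)
  qed
  then show ?thesis
    unfolding taylor_def monoid_ring_lift_def coeff_sum coeff_mult_0 coeff_0_linear_power
      variable_power coeff_pCons_0
    by (simp only: sum_single_lookup)
qed

lemma coeff_1_taylor: "coeff (taylor i f) 1 = partial_deriv i f"
  unfolding taylor_def monoid_ring_lift_def partial_deriv_def coeff_sum
proof (rule sum.cong)
  fix m
  let ?k = "Poly_Mapping.lookup m i" and ?c = "Poly_Mapping.lookup f m"
  have exp: "m - Poly_Mapping.single i ?k + Poly_Mapping.single i (?k - 1) = m - Poly_Mapping.single i 1"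
    if "?k > 0"
    by (rule poly_mapping_eqI)
      (use that in \<open>auto simp: lookup_add lookup_minus lookup_single when_def\<close>)
  have "Poly_Mapping.single 0 ?c * (Poly_Mapping.single (m - Poly_Mapping.single i ?k) 1
      * (of_nat ?k * Poly_Mapping.single (Poly_Mapping.single i (?k - 1)) 1))
    = Poly_Mapping.single (m - Poly_Mapping.single i 1) (of_nat ?k * ?c)"
  proof (cases "?k = 0")
    case False
    have of_nat: "(of_nat ?k :: ('a, 'b) mpoly) = Poly_Mapping.single 0 (of_nat ?k)" by simp
    show ?thesis
      unfolding of_nat mult_single
      using exp False by (simp add: add.assoc mult.commute del: One_nat_def)
  qed simp
  moreover have "coeff ([:a:] * ([:b:] * F)) 1 = a * (b * coeff F 1)"
    for a b and F :: "('a, 'b) mpoly poly"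
    by (simp add: mult_ac del: One_nat_def)
  ultimately show "coeff ([:Poly_Mapping.single 0 ?c:]
      * ([:Poly_Mapping.single (m - Poly_Mapping.single i ?k) 1:]
        * [:Poly_Mapping.single (Poly_Mapping.single i 1) 1, 1:] ^ ?k)) 1
    = Poly_Mapping.single (m - Poly_Mapping.single i 1) (of_nat ?k * ?c)"
    by (simp only: coeff_1_linear_power variable_power)
qed simp

lemma mpoly_rational:
  assumes "n > 0"
  shows "\<exists>c :: ('n, 'k::field_char_0) mpoly. of_nat n * c = 1"
proof
  show "of_nat n * Poly_Mapping.single 0 (1 / of_nat n) = (1 :: ('n, 'k) mpoly)"
    using assms by (simp add: mult_single single_of_nat[symmetric] del: single_of_nat)
qed

lemma partial_deriv_fractional_power:
  fixes f :: "('n, 'k::field_char_0) mpoly"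
  assumes "0 < q" "q \<le> p" "f \<in> fractional_power I p q"
  shows "partial_deriv i f \<in> fractional_power I (p - q) q"
  using first_order_coeff_in_fractional_power[OF mpoly_rational comm_ring_hom_taylor coeff_0_taylor assms]
  by (simp only: coeff_1_taylor)

text \<open>The first-order coefficient of a multiplicative map whose constant coefficient is the identity obeys
  the product rule.\<close>

lemma partial_deriv_mult:
  "partial_deriv i (f * g) = partial_deriv i f * g + f * partial_deriv i g"
proof -
  interpret comm_ring_hom "taylor i :: ('a, 'b) mpoly \<Rightarrow> _" by (rule comm_ring_hom_taylor)
  show ?thesis
    unfolding coeff_1_taylor[symmetric] hom_mult
    by (simp add: coeff_mult coeff_0_taylor add.commute)
qed

section \<open>Symbolic fractional powers\<close>

text \<open>Elements of the extended ideal have the form \<open>x / s\<close> with \<open>x \<in> J\<close> and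
  \<open>s \<notin> P\<close>: put the finitely many coefficients over a common denominator.\<close>

lemma local_contraction_iff:
  assumes P: "prime_ideal P" and J: "ideal.subspace J"
  shows "f \<in> local_contraction P J \<longleftrightarrow> (\<exists>s. s \<notin> P \<and> s * f \<in> J)"
proof
  have "0 \<in> P" using P by (simp add: prime_ideal_def ideal.subspace_0)
  then have nz: "s \<noteq> 0" if "s \<notin> P" for s using that by auto
  {
    assume "f \<in> local_contraction P J"
    then obtain n :: nat and c g where "Fract f 1 = (\<Sum>i<n. c i * Fract (g i) 1)
        \<and> (\<forall>i<n. c i \<in> localization P \<and> g i \<in> J)"
      unfolding local_contraction_def local_extension_def mem_Collect_eq by (elim exE) (rule that)
    then have f: "Fract f 1 = (\<Sum>i<n. c i * Fract (g i) 1)"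
      and cg: "\<And>i. i < n \<Longrightarrow> c i \<in> localization P \<and> g i \<in> J" by simp_all
    have "\<exists>s x. s \<notin> P \<and> x \<in> J \<and> (\<Sum>i<m. c i * Fract (g i) 1) = Fract x s" if "m \<le> n" for m
      using that
    proof (induction m)
      case 0
      have "1 \<notin> P"
        using P unfolding prime_ideal_def
        by (metis UNIV_eq_I ideal.subspace_scale mult.right_neutral)
      then show ?case using ideal.subspace_0[OF J] by (auto simp: Zero_fract_def)
    next
      case (Suc m)
      then obtain s x where s: "s \<notin> P" "x \<in> J" "(\<Sum>i<m. c i * Fract (g i) 1) = Fract x s" by auto
      obtain r t where t: "t \<notin> P" "c m = Fract r t"
        using cg[of m] Suc.prems by (auto simp: localization_def)
      have "(\<Sum>i<Suc m. c i * Fract (g i) 1) = Fract (t * x + (s * r) * g m) (s * t)"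
        using nz s t by (simp add: mult_ac)
      moreover have "s * t \<notin> P" using P s t by (auto simp: prime_ideal_def)
      moreover have "t * x + (s * r) * g m \<in> J"
        using cg[of m] Suc.prems s(2)
        by (intro ideal.subspace_add[OF J] ideal.subspace_scale[OF J]) auto
      ultimately show ?case by blast
    qed
    from this[of n] obtain s x where s: "s \<notin> P" "x \<in> J" "Fract f 1 = Fract x s"
      using f by auto
    then have "s * f = x" using nz[OF s(1)] by (simp add: eq_fract mult.commute)
    then show "\<exists>s. s \<notin> P \<and> s * f \<in> J" using s by blast
  }
  {
    assume "\<exists>s. s \<notin> P \<and> s * f \<in> J"
    then obtain s where s: "s \<notin> P" "s * f \<in> J" by blast
    have "Fract f 1 = (\<Sum>i<(1::nat). Fract 1 s * Fract (s * f) 1)"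
      using nz[OF s(1)] by (simp add: eq_fract)
    moreover have "Fract 1 s \<in> localization P" using s(1) by (auto simp: localization_def)
    ultimately show "f \<in> local_contraction P J"
      unfolding local_contraction_def local_extension_def mem_Collect_eq
      using s(2) by (intro exI[of _ 1] exI[of _ "\<lambda>_. Fract 1 s"] exI[of _ "\<lambda>_. s * f"]) simp
  }
qed

lemma Ass_prime: "P \<in> Ass I \<Longrightarrow> prime_ideal P"
  by (simp add: Ass_def)

text \<open>If \<open>Q\<close> is the annihilator of the class of \<open>g\<close>, its preimage under
  \<open>\<sigma>\<close> is the annihilator of the class of \<open>\<tau> g\<close>.\<close>

lemma vimage_Ass:
  assumes s: "comm_ring_hom \<sigma>" and t: "comm_ring_hom \<tau>"
    and st: "\<And>x. \<sigma> (\<tau> x) = x" and ts: "\<And>x. \<tau> (\<sigma> x) = x"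
    and sI: "\<sigma> ` I \<subseteq> I" and tI: "\<tau> ` I \<subseteq> I" and Q: "Q \<in> Ass I"
  shows "{x. \<sigma> x \<in> Q} \<in> Ass I"
proof -
  interpret s: comm_ring_hom \<sigma> by fact
  interpret t: comm_ring_hom \<tau> by fact
  obtain g where Qp: "prime_ideal Q" and Qg: "Q = {r. r * g \<in> I}" using Q by (auto simp: Ass_def)
  have "{x. \<sigma> x \<in> Q} \<noteq> UNIV"
    using Qp st unfolding prime_ideal_def by (metis UNIV_I UNIV_eq_I mem_Collect_eq)
  then have "prime_ideal {x. \<sigma> x \<in> Q}"
    using Qp subspace_vimage[OF s] by (auto simp: prime_ideal_def s.hom_mult)
  moreover have "\<sigma> r * g \<in> I \<longleftrightarrow> r * \<tau> g \<in> I" for r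
  proof
    assume "\<sigma> r * g \<in> I"
    then have "\<tau> (\<sigma> r * g) \<in> I" using tI by blast
    then show "r * \<tau> g \<in> I" by (simp add: t.hom_mult ts)
  next
    assume "r * \<tau> g \<in> I"
    then have "\<sigma> (r * \<tau> g) \<in> I" using sI by blast
    then show "\<sigma> r * g \<in> I" by (simp add: s.hom_mult st)
  qed
  then have "{x. \<sigma> x \<in> Q} = {r. r * \<tau> g \<in> I}" by (simp add: Qg)
  ultimately show ?thesis unfolding Ass_def by blast
qed

definition fractional_symbolic_power :: "'a::idom set \<Rightarrow> nat \<Rightarrow> nat \<Rightarrow> 'a set" where
  "fractional_symbolic_power I p q =
    {f. \<forall>P\<in>Ass I. \<exists>s. s \<notin> P \<and> s * f \<in> fractional_power I p q}"

lemma rational_symbolic_power_eq: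
  assumes "quotient_of u = (p, q)"
  shows "rational_symbolic_power I u = fractional_symbolic_power I (nat p) (nat q)"
proof -
  have "rational_power I u = fractional_power I (nat p) (nat q)"
    using assms by (simp add: rational_power_def fractional_power_def)
  moreover have "nat q > 0" using quotient_of_denom_pos[OF assms] by simp
  ultimately show ?thesis
    unfolding rational_symbolic_power_def fractional_symbolic_power_def
    using local_contraction_iff[OF Ass_prime subspace_fractional_power] by fastforce
qed

lemma subspace_fractional_symbolic_power:
  assumes q: "q > 0" shows "ideal.subspace (fractional_symbolic_power I p q)"
proof -
  let ?J = "fractional_power I p q"
  have J: "ideal.subspace ?J" by (rule subspace_fractional_power[OF q])
  have zero: "\<exists>s. s \<notin> P \<and> s * 0 \<in> ?J" if "P \<in> Ass I" for P
    using Ass_prime[OF that] ideal.subspace_0[OF J] by (auto simp: prime_ideal_def)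
  have add: "\<exists>s. s \<notin> P \<and> s * (f + g) \<in> ?J"
    if "P \<in> Ass I" "s \<notin> P" "s * f \<in> ?J" "t \<notin> P" "t * g \<in> ?J" for P f g s t
  proof (intro exI conjI)
    show "s * t \<notin> P" using Ass_prime[OF that(1)] that by (auto simp: prime_ideal_def)
    have "s * t * (f + g) = t * (s * f) + s * (t * g)" by (simp add: algebra_simps)
    then show "s * t * (f + g) \<in> ?J"
      using that by (simp add: ideal.subspace_add[OF J] ideal.subspace_scale[OF J])
  qed
  have scale: "\<exists>s. s \<notin> P \<and> s * (c * f) \<in> ?J"
    if "s \<notin> P" "s * f \<in> ?J" for P c f s
    using that ideal.subspace_scale[OF J, of "s * f" c] by (metis mult.left_commute)
  show ?thesis
    unfolding ideal.subspace_def fractional_symbolic_power_def mem_Collect_eq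
  proof (intro conjI ballI allI)
    show "\<exists>s. s \<notin> P \<and> s * 0 \<in> ?J" if "P \<in> Ass I" for P by (rule zero[OF that])
    fix f P
    assume "f \<in> {f. \<forall>P\<in>Ass I. \<exists>s. s \<notin> P \<and> s * f \<in> ?J}" and P: "P \<in> Ass I"
    then obtain s where s: "s \<notin> P" "s * f \<in> ?J" by blast
    show "\<exists>s. s \<notin> P \<and> s * (c * f) \<in> ?J" for c by (rule scale[OF s])
    fix g assume "g \<in> {f. \<forall>P\<in>Ass I. \<exists>s. s \<notin> P \<and> s * f \<in> ?J}"
    then obtain t where t: "t \<notin> P" "t * g \<in> ?J" using P by blast
    show "\<exists>s. s \<notin> P \<and> s * (f + g) \<in> ?J" by (rule add[OF P s t])
  qed
qed

lemma fractional_symbolic_power_automorphism: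
  assumes s: "comm_ring_hom \<sigma>" and t: "comm_ring_hom \<tau>"
    and st: "\<And>x. \<sigma> (\<tau> x) = x" and ts: "\<And>x. \<tau> (\<sigma> x) = x"
    and sI: "\<sigma> ` I \<subseteq> I" and tI: "\<tau> ` I \<subseteq> I"
    and f: "f \<in> fractional_symbolic_power I p q"
  shows "\<sigma> f \<in> fractional_symbolic_power I p q"
  unfolding fractional_symbolic_power_def
proof (intro CollectI ballI)
  fix Q assume "Q \<in> Ass I"
  then have pre: "{x. \<sigma> x \<in> Q} \<in> Ass I"
    by (rule vimage_Ass[OF s t st ts sI tI])
  have "\<forall>P\<in>Ass I. \<exists>r. r \<notin> P \<and> r * f \<in> fractional_power I p q"
    using f by (simp add: fractional_symbolic_power_def)
  from bspec[OF this pre] have "\<exists>r. r \<notin> {x. \<sigma> x \<in> Q} \<and> r * f \<in> fractional_power I p q"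
    .
  then obtain r where r: "\<sigma> r \<notin> Q" "r * f \<in> fractional_power I p q" by auto
  interpret s: comm_ring_hom \<sigma> by fact
  have "\<sigma> r * \<sigma> f \<in> fractional_power I p q"
    using fractional_power_hom[OF s sI r(2)] by (simp add: s.hom_mult)
  then show "\<exists>s. s \<notin> Q \<and> s * \<sigma> f \<in> fractional_power I p q" using r(1) by blast
qed

text \<open>The denominator has to be squared: \<open>\<partial>(s f)\<close> also contains \<open>f
  \<partial>s\<close>, which becomes a multiple of \<open>s f\<close> only after multiplication by
  \<open>s\<close>.\<close>

lemma partial_deriv_fractional_symbolic_power:
  fixes f :: "('n::linorder, 'k::field_char_0) mpoly"
  assumes q: "0 < q" "q \<le> p" and f: "f \<in> fractional_symbolic_power I p q"
  shows "partial_deriv i f \<in> fractional_symbolic_power I (p - q) q"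
  unfolding fractional_symbolic_power_def
proof (intro CollectI ballI)
  fix P assume P: "P \<in> Ass I"
  then obtain s where s: "s \<notin> P" "s * f \<in> fractional_power I p q"
    using f unfolding fractional_symbolic_power_def by blast
  let ?J = "fractional_power I (p - q) q"
  have J: "ideal.subspace ?J" by (rule subspace_fractional_power[OF q(1)])
  have d: "partial_deriv i (s * f) \<in> ?J" by (rule partial_deriv_fractional_power[OF q s(2)])
  have sf: "s * f \<in> ?J" using s(2) fractional_power_antimono[of "p - q" p I q] by auto
  have "(s * s) * partial_deriv i f = s * partial_deriv i (s * f) - partial_deriv i s * (s * f)"
    by (simp add: partial_deriv_mult algebra_simps)
  also have "\<dots> \<in> ?J"
    by (intro ideal.subspace_diff[OF J] ideal.subspace_scale[OF J] d sf)
  finally show "\<exists>s. s \<notin> P \<and> s * partial_deriv i f \<in> ?J"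
    using s(1) Ass_prime[OF P] unfolding prime_ideal_def by blast
qed

lemma fractional_symbolic_power_mult:
  assumes q: "q > 0"
    and f: "f \<in> fractional_symbolic_power I a q" and g: "g \<in> fractional_symbolic_power I b q"
    and "c \<le> a + b"
  shows "f * g \<in> fractional_symbolic_power I c q"
  unfolding fractional_symbolic_power_def
proof (intro CollectI ballI)
  fix P assume P: "P \<in> Ass I"
  obtain s t where s: "s \<notin> P" "s * f \<in> fractional_power I a q"
    and t: "t \<notin> P" "t * g \<in> fractional_power I b q"
    using P f g unfolding fractional_symbolic_power_def by blast
  have "(s * f) * (t * g) \<in> fractional_power I c q"
    using fractional_power_mult[OF q s(2) t(2)] fractional_power_antimono[OF assms(4)] by blast
  then have "(s * t) * (f * g) \<in> fractional_power I c q" by (simp add: mult_ac)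
  moreover have "s * t \<notin> P" using s(1) t(1) Ass_prime[OF P] by (auto simp: prime_ideal_def)
  ultimately show "\<exists>s. s \<notin> P \<and> s * (f * g) \<in> fractional_power I c q" by blast
qed

lemma ideal_power_2_span_subset:
  assumes J: "ideal.subspace J" and "\<And>x y. x \<in> X \<Longrightarrow> y \<in> X \<Longrightarrow> x * y \<in> J"
  shows "ideal_power (ideal.span X) 2 \<subseteq> J"
proof -
  have "ideal.span X \<subseteq> {x. \<forall>y\<in>X. x * y \<in> J}"
    using assms by (intro ideal.span_minimal subspace_multiplier) auto
  then have "x * y \<in> J" if "x \<in> X" "y \<in> ideal.span X" for x y
    using that by (subst mult.commute) auto
  then have "ideal.span X \<subseteq> {x. \<forall>y\<in>ideal.span X. x * y \<in> J}"
    by (intro ideal.span_minimal subspace_multiplier J) auto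
  moreover have "ideal_prod (ideal.span X) UNIV \<subseteq> ideal.span X"
    by (intro ideal_prod_least ideal.subspace_span) (subst mult.commute, rule ideal.span_scale)
  ultimately have "ideal_prod (ideal.span X) (ideal_prod (ideal.span X) UNIV) \<subseteq> J"
    by (intro ideal_prod_least[OF _ J]) auto
  then show ?thesis by (simp add: numeral_2_eq_2)
qed

text \<open>With \<open>u = p / q\<close>, derivatives have exponent \<open>u - 1\<close> and their products
  \<open>2 u - 2 \<ge> u\<close>.\<close>

lemma derivative_ideal_fractional_symbolic_power:
  fixes I :: "('n::linorder, 'k::field_char_0) mpoly set"
  assumes q: "0 < q" "2 * q \<le> p"
  shows "ideal_power (derivative_ideal (fractional_symbolic_power I p q)) 2
    \<subseteq> fractional_symbolic_power I p q"
  unfolding derivative_ideal_def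
proof (rule ideal_power_2_span_subset[OF subspace_fractional_symbolic_power[OF q(1)]])
  fix x y
  assume x: "x \<in> {partial_deriv i f |i f. f \<in> fractional_symbolic_power I p q}"
    and y: "y \<in> {partial_deriv i f |i f. f \<in> fractional_symbolic_power I p q}"
  have "z \<in> fractional_symbolic_power I (p - q) q"
    if "z \<in> {partial_deriv i f |i f. f \<in> fractional_symbolic_power I p q}" for z
  proof -
    have "q \<le> p" using q by simp
    then show ?thesis
      using that partial_deriv_fractional_symbolic_power[OF q(1)] by blast
  qed
  from this[OF x] this[OF y] show "x * y \<in> fractional_symbolic_power I p q"
    by (rule fractional_symbolic_power_mult[OF q(1)]) (use q in simp)
qed

section \<open>Dilations and homogeneity\<close>

lemma monomial_degree_add: "monomial_degree (m + n) = monomial_degree m + monomial_degree n"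
  by (simp add: monomial_degree_def lookup_add sum.distrib)

text \<open>The substitution \<open>x\<^sub>i \<mapsto> a x\<^sub>i\<close> for all variables at once.\<close>

definition dilation :: "'k \<Rightarrow> ('n::finite, 'k::comm_ring_1) mpoly \<Rightarrow> ('n, 'k) mpoly" where
  "dilation a = monoid_ring_lift (Poly_Mapping.single 0)
    (\<lambda>m. Poly_Mapping.single m (a ^ monomial_degree m))"

lemma comm_ring_hom_dilation: "comm_ring_hom (dilation a)"
  unfolding dilation_def
  by (rule comm_ring_hom_monoid_ring_lift[OF comm_ring_hom_const])
    (simp add: monomial_degree_def, simp add: monomial_degree_add power_add mult_single)

lemma lookup_dilation:
  "Poly_Mapping.lookup (dilation a f) m = a ^ monomial_degree m * Poly_Mapping.lookup f m"
  unfolding dilation_def monoid_ring_lift_def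
  by (auto simp: mult_single lookup_sum lookup_single when_def in_keys_iff mult.commute)

lemma dilation_inverse: "a * b = 1 \<Longrightarrow> dilation a (dilation b f) = f"
  by (rule poly_mapping_eqI)
    (simp add: lookup_dilation mult.assoc[symmetric] power_mult_distrib[symmetric])

lemma lookup_const_mult:
  "Poly_Mapping.lookup (Poly_Mapping.single (0 :: 'm::comm_monoid_add) (c :: 'k::comm_ring_1) * f) m
    = c * Poly_Mapping.lookup f m"
  by (simp add: mult_map_scale_conv_mult[symmetric] map.rep_eq when_def)

lemma dilation_homogeneous_ideal:
  assumes "homogeneous_ideal I"
  shows "dilation a ` I \<subseteq> I"
proof -
  obtain S where S: "\<And>f. f \<in> S \<Longrightarrow> homogeneous f" and I: "I = ideal.span S"
    using assms unfolding homogeneous_ideal_def by blast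
  have "ideal.span S \<subseteq> {f. dilation a f \<in> ideal.span S}"
  proof (rule ideal.span_minimal[OF _ subspace_vimage[OF comm_ring_hom_dilation ideal.subspace_span]])
    show "S \<subseteq> {f. dilation a f \<in> ideal.span S}"
    proof
      fix f assume f: "f \<in> S"
      then obtain n where n: "\<And>m. m \<in> Poly_Mapping.keys f \<Longrightarrow> monomial_degree m = n"
        using S unfolding homogeneous_def by blast
      have "dilation a f = Poly_Mapping.single 0 (a ^ n) * f"
        by (rule poly_mapping_eqI)
          (metis lookup_dilation lookup_const_mult in_keys_iff mult_zero_right n)
      then show "f \<in> {f. dilation a f \<in> ideal.span S}"
        by (simp add: f ideal.span_base ideal.span_scale)
    qed
  qed
  then show ?thesis unfolding I by auto
qed

definition homogeneous_component ::
    "nat \<Rightarrow> ('n::finite, 'k::comm_ring_1) mpoly \<Rightarrow> ('n, 'k) mpoly" where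
  "homogeneous_component d f = (\<Sum>m\<in>{m \<in> Poly_Mapping.keys f. monomial_degree m = d}.
    Poly_Mapping.single m (Poly_Mapping.lookup f m))"

lemma lookup_homogeneous_component:
  "Poly_Mapping.lookup (homogeneous_component d f) m
    = (if monomial_degree m = d then Poly_Mapping.lookup f m else 0)"
  by (auto simp: homogeneous_component_def lookup_sum lookup_single when_def in_keys_iff)

lemma homogeneous_homogeneous_component: "homogeneous (homogeneous_component d f)"
  unfolding homogeneous_def
  by (rule exI[of _ d]) (auto simp: in_keys_iff lookup_homogeneous_component split: if_splits)

lemma dilation_eq_sum_components:
  assumes "\<And>m. m \<in> Poly_Mapping.keys f \<Longrightarrow> monomial_degree m < N"
  shows "dilation a f = (\<Sum>d<N. Poly_Mapping.single 0 (a ^ d) * homogeneous_component d f)"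
proof (rule poly_mapping_eqI)
  fix m
  have "a ^ monomial_degree m * Poly_Mapping.lookup f m
      = (\<Sum>d<N. if monomial_degree m = d then a ^ d * Poly_Mapping.lookup f m else 0)"
    using assms[of m] by (cases "Poly_Mapping.lookup f m = 0") (auto simp: in_keys_iff)
  also have "\<dots> = (\<Sum>d<N. a ^ d * (if monomial_degree m = d then Poly_Mapping.lookup f m else 0))"
    by (rule sum.cong) auto
  finally show "Poly_Mapping.lookup (dilation a f) m = Poly_Mapping.lookup
      (\<Sum>d<N. Poly_Mapping.single 0 (a ^ d) * homogeneous_component d f) m"
    by (simp add: lookup_dilation lookup_sum lookup_const_mult lookup_homogeneous_component)
qed

text \<open>The dilation by \<open>2\<^sup>k\<close> multiplies the component of degree \<open>d\<close> by
  \<open>(2\<^sup>k)\<^sup>d\<close>, so that components are extracted by the Vandermonde argument.\<close>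

lemma homogeneous_ideal_if_dilation_stable:
  fixes J :: "('n::finite, 'k::field_char_0) mpoly set"
  assumes J: "ideal.subspace J" and stable: "\<And>a f. a \<noteq> 0 \<Longrightarrow> f \<in> J \<Longrightarrow> dilation a f \<in> J"
  shows "homogeneous_ideal J"
proof -
  have component: "(\<forall>d. homogeneous_component d f \<in> J)
      \<and> (\<exists>N. f = (\<Sum>d<N. homogeneous_component d f))" if f: "f \<in> J" for f
  proof -
    define N0 where "N0 = Suc (Max (insert 0 (monomial_degree ` Poly_Mapping.keys f)))"
    have N0: "monomial_degree m < N0" if "m \<in> Poly_Mapping.keys f" for m
      using that unfolding N0_def by (simp add: less_Suc_eq_le)
    have "homogeneous_component d f \<in> J" for d
    proof (rule mem_if_geometric_combinations_mem[OF J divisible_if_rational[OF mpoly_rational J]])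
      \<comment> \<open>The bound must exceed both \<open>d\<close> itself and every degree occurring in \<open>f\<close>.\<close>
      show "d < max N0 (Suc d)" by simp
      fix k
      have "(2 ^ k) ^ d = (Poly_Mapping.single 0 ((2 ^ k) ^ d) :: ('n, 'k) mpoly)" for d
        by (metis of_nat_numeral of_nat_power single_of_nat)
      then have "(\<Sum>d<max N0 (Suc d). (2 ^ k) ^ d * homogeneous_component d f) = dilation (2 ^ k) f"
        using N0 by (subst dilation_eq_sum_components[of f "max N0 (Suc d)"]) (auto simp: less_max_iff_disj)
      then show "(\<Sum>d<max N0 (Suc d). (2 ^ k) ^ d * homogeneous_component d f) \<in> J"
        using stable[OF _ f] by simp
    qed
    moreover have "f = (\<Sum>d<N0. homogeneous_component d f)"
    proof -
      have "dilation 1 f = f" by (rule poly_mapping_eqI) (simp add: lookup_dilation)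
      then show ?thesis using dilation_eq_sum_components[of f N0 1, OF N0] by simp
    qed
    ultimately show ?thesis by blast
  qed
  have generated: "J = ideal.span {f \<in> J. homogeneous f}"
  proof
    show "J \<subseteq> ideal.span {f \<in> J. homogeneous f}"
    proof
      fix f assume f: "f \<in> J"
      then obtain N where "f = (\<Sum>d<N. homogeneous_component d f)" using component by blast
      also have "\<dots> \<in> ideal.span {f \<in> J. homogeneous f}"
        using component[OF f] homogeneous_homogeneous_component
        by (intro ideal.span_sum ideal.span_base) auto
      finally show "f \<in> ideal.span {f \<in> J. homogeneous f}" .
    qed
    show "ideal.span {f \<in> J. homogeneous f} \<subseteq> J" by (rule ideal.span_minimal[OF _ J]) auto
  qed
  show ?thesis
    unfolding homogeneous_ideal_def
    by (rule exI[of _ "{f \<in> J. homogeneous f}"], rule conjI[OF _ generated]) simp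
qed

theorem proposition3p5:
  fixes I :: "('n::{finite,linorder}, 'k::field_char_0) mpoly set"
    and u :: rat
  assumes "homogeneous_ideal I"
    and "u \<ge> 2"
  shows "strongly_Golod (rational_symbolic_power I u)"
proof -
  obtain a b where ab: "quotient_of u = (a, b)" by force
  have b: "b > 0" by (rule quotient_of_denom_pos[OF ab])
  have "2 * rat_of_int b \<le> rat_of_int a"
    using quotient_of_div[OF ab] b mult_right_mono[OF \<open>u \<ge> 2\<close>, of "of_int b"] by simp
  then have "2 * b \<le> a" by linarith
  then have q: "0 < nat b" "2 * nat b \<le> nat a" using b by auto
  let ?J = "fractional_symbolic_power I (nat a) (nat b)"
  have "dilation c f \<in> ?J" if "c \<noteq> 0" "f \<in> ?J" for c f
  proof (rule fractional_symbolic_power_automorphism[OF _ _ _ _ _ _ that(2)])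
    show "dilation c (dilation (1 / c) x) = x" "dilation (1 / c) (dilation c x) = x" for x
      using that(1) by (simp_all add: dilation_inverse)
  qed (rule comm_ring_hom_dilation dilation_homogeneous_ideal assms(1))+
  then have "homogeneous_ideal ?J"
    by (intro homogeneous_ideal_if_dilation_stable subspace_fractional_symbolic_power q)
  then show ?thesis
    unfolding strongly_Golod_def rational_symbolic_power_eq[OF ab]
    using derivative_ideal_fractional_symbolic_power[OF q] by blast
qed

end
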